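(* Assume that Assumption 1 and Assumption 2 (both stated in the context) hold. For $X\in\mathcal{B}_N$ let $\ell(X)$ be the length of a minimal factorization of $X$. Then for all $N$ and $X\in\mathcal{B}_N$, $\ell(X)=\ell_\tau(X)$, where $\ell_\tau(X):=\ell(\tau(X))$ is the number of crossings of the tangle $\tau(X)\in S_N$, and $\ell_\tau(X)$ can be computed from $X$ in time $\mathcal{O}(N^2)$.
   Context: For an integer $N\ge 0$, take upper nodes $1,\dots,N$ and lower nodes $1',\dots,N'$ arranged in two rows. A tangle is a set of $N$ edges such that each node is in exactly one edge (a perfect matching of the $2N$ nodes). The composition $X\circ Y$ is obtained by stacking $X$ on top of $Y$, identifying lower node $i'$ of $X$ with upper node $i$ of $Y$, tracing paths, and discarding internal loops. The Brauer monoid $\mathcal{B}_N$ is the monoid of all tangles, with identity $I_N=\{(i,i'):1\le i\le N\}$. It is generated by the primes, for $1\le i\le N-1$: the $T$-prime $T_i$, obtained from $I_N$ by replacing $(i,i'),(i+1,(i+1)')$ with $(i,(i+1)'),(i+1,i')$; and the $U$-prime $U_i$, obtained from $I_N$ by replacing these two edges with $(i,i+1),(i',(i+1)')$. $S_N$ is the submonoid generated by the $T_i$ (the symmetric group). A factorization of $X$ is a word in the primes whose composition is $X$ (the empty word is a factorization of $I_N$); it is minimal if no shorter word has the same composition. Two edges cross if they intersect in the diagram of the tangle drawn inside the rectangle with the minimum number of crossings (equivalently, their endpoints interleave in the cyclic order $1,\dots,N,N',\dots,1'$); the number of crossings of a tangle is the number of crossing pairs of edges. For a word $F$ in the primes,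 $\tau(F)$ is the word obtained by replacing each $U_i$ by $T_i$ and keeping each $T_i$. For a tangle $X$, $\tau(X)\in S_N$ is the tangle obtained by composing $\tau(F)$, where $F$ is a minimal factorization of $X$; the result is independent of the choice of $F$. Rewriting rules on words. Delete rules (applied left to right): $T_iT_i\to$ empty word; $U_iU_i\to U_i$; $T_iU_i\to U_i$; $U_iT_i\to U_i$; and for $|i-j|=1$: $U_iU_jU_i\to U_i$; $U_iT_jU_i\to U_i$; $T_iU_jU_i\to T_jU_i$; $U_iU_jT_i\to U_iT_j$; $U_iT_jT_i\to U_iU_j$; $T_iT_jU_i\to U_jU_i$. Braid rules, for $|i-j|=1$: $T_iT_jT_i= T_jT_iT_j$; $T_iU_jT_i= T_jU_iT_j$. Swap rules, for $|i-j|>1$: any prime of index $i$ commutes with any prime of index $j$. Assumption 1: for every $N$, every factorization in $\mathcal{B}_N$ can be transformed into a minimal one by a sequence of delete, braid and swap rules (the length never needs to be increased). Assumption 2: if a tangle $X$ has $k$ crossings, then there exists a minimal factorization of $X$ with exactly $k$ $T$-primes, and no factorization of $X$ has fewer $T$-primes. Running time counts elementary operations on node labels as constant time. *)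

theory Defs
  imports Complex_Main "HOL-Library.Landau_Symbols"
begin

section \<open>Tangles and their composition\<close>

text \<open>\<open>Up i\<close> is the upper node \<open>i\<close> and \<open>Low i\<close> the lower node \<open>i'\<close>; both rows are
  numbered from 1. An edge is a two-element set of nodes.\<close>

datatype node = Up nat | Low nat

type_synonym tangle = "node set set"

definition nodes :: "nat \<Rightarrow> node set" where
  "nodes N = Up ` {1..N} \<union> Low ` {1..N}"

definition tangles :: "nat \<Rightarrow> tangle set" where
  "tangles N = {X. (\<forall>e\<in>X. e \<subseteq> nodes N \<and> card e = 2) \<and> (\<forall>v\<in>nodes N. \<exists>!e. e \<in> X \<and> v \<in> e)}"

definition id_tangle :: "nat \<Rightarrow> tangle" where
  "id_tangle N = {{Up i, Low i} | i. 1 \<le> i \<and> i \<le> N}"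

text \<open>Stacking \<open>X\<close> on top of \<open>Y\<close> gives a diagram with three rows of nodes; the middle one
  arises from identifying the lower row of \<open>X\<close> with the upper row of \<open>Y\<close>.\<close>

datatype stacked_node = Top nat | Mid nat | Bot nat

fun in_upper :: "node \<Rightarrow> stacked_node" where
  "in_upper (Up i) = Top i"
| "in_upper (Low i) = Mid i"

fun in_lower :: "node \<Rightarrow> stacked_node" where
  "in_lower (Up i) = Mid i"
| "in_lower (Low i) = Bot i"

fun outer :: "node \<Rightarrow> stacked_node" where
  "outer (Up i) = Top i"
| "outer (Low i) = Bot i"

definition stack_adj :: "tangle \<Rightarrow> tangle \<Rightarrow> (stacked_node \<times> stacked_node) set" where
  "stack_adj X Y = {(in_upper a, in_upper b) | a b. a \<noteq> b \<and> {a, b} \<in> X}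
                 \<union> {(in_lower a, in_lower b) | a b. a \<noteq> b \<and> {a, b} \<in> Y}"

text \<open>In the stacked diagram the outer nodes have degree 1 and the middle nodes degree 2, so two
  distinct outer nodes are connected iff they are the two ends of one path. Internal loops
  contain no outer node and hence contribute nothing.\<close>

definition tangle_comp :: "tangle \<Rightarrow> tangle \<Rightarrow> tangle" where
  "tangle_comp X Y = {{a, b} | a b. a \<noteq> b \<and> (outer a, outer b) \<in> (stack_adj X Y)\<^sup>*}"

section \<open>Primes and factorizations\<close>

datatype prime = TP nat | UP nat

fun prime_index :: "prime \<Rightarrow> nat" where
  "prime_index (TP i) = i"
| "prime_index (UP i) = i"

fun is_TP :: "prime \<Rightarrow> bool" where
  "is_TP (TP i) = True"
| "is_TP (UP i) = False"

fun prime_tangle :: "nat \<Rightarrow> prime \<Rightarrow> tangle" where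
  "prime_tangle N (TP i) = (id_tangle N - {{Up i, Low i}, {Up (i + 1), Low (i + 1)}})
     \<union> {{Up i, Low (i + 1)}, {Up (i + 1), Low i}}"
| "prime_tangle N (UP i) = (id_tangle N - {{Up i, Low i}, {Up (i + 1), Low (i + 1)}})
     \<union> {{Up i, Up (i + 1)}, {Low i, Low (i + 1)}}"

type_synonym word = "prime list"

definition words :: "nat \<Rightarrow> word set" where
  "words N = {F. \<forall>p\<in>set F. 1 \<le> prime_index p \<and> prime_index p + 1 \<le> N}"

fun compose_word :: "nat \<Rightarrow> word \<Rightarrow> tangle" where
  "compose_word N [] = id_tangle N"
| "compose_word N (p # F) = tangle_comp (prime_tangle N p) (compose_word N F)"

definition factorization :: "nat \<Rightarrow> tangle \<Rightarrow> word \<Rightarrow> bool" where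
  "factorization N X F \<longleftrightarrow> F \<in> words N \<and> compose_word N F = X"

definition minimal_factorization :: "nat \<Rightarrow> tangle \<Rightarrow> word \<Rightarrow> bool" where
  "minimal_factorization N X F \<longleftrightarrow>
     factorization N X F \<and> (\<forall>G. factorization N X G \<longrightarrow> length F \<le> length G)"

text \<open>The length of a minimal factorization.\<close>

definition tangle_length :: "nat \<Rightarrow> tangle \<Rightarrow> nat" where
  "tangle_length N X = (LEAST n. \<exists>F. factorization N X F \<and> length F = n)"

definition sym_tangles :: "nat \<Rightarrow> tangle set" where
  "sym_tangles N = {X. \<exists>F. factorization N X F \<and> (\<forall>p\<in>set F. is_TP p)}"

section \<open>Crossings\<close>

text \<open>Position of a node in the cyclic order \<open>1, \<dots>, N, N', \<dots>, 1'\<close>.\<close>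

fun cyc_pos :: "nat \<Rightarrow> node \<Rightarrow> nat" where
  "cyc_pos N (Up i) = i"
| "cyc_pos N (Low i) = 2 * N + 1 - i"

definition crosses :: "nat \<Rightarrow> node set \<Rightarrow> node set \<Rightarrow> bool" where
  "crosses N e f \<longleftrightarrow> (\<exists>a b c d. e = {a, b} \<and> f = {c, d} \<and>
     (cyc_pos N a < cyc_pos N c \<and> cyc_pos N c < cyc_pos N b \<and> cyc_pos N b < cyc_pos N d \<or>
      cyc_pos N c < cyc_pos N a \<and> cyc_pos N a < cyc_pos N d \<and> cyc_pos N d < cyc_pos N b))"

definition crossings :: "nat \<Rightarrow> tangle \<Rightarrow> nat" where
  "crossings N X = card {{e, f} | e f. e \<in> X \<and> f \<in> X \<and> crosses N e f}"

section \<open>The map \<open>\<tau>\<close>\<close>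

fun tau_prime :: "prime \<Rightarrow> prime" where
  "tau_prime (TP i) = TP i"
| "tau_prime (UP i) = TP i"

definition tau_word :: "word \<Rightarrow> word" where
  "tau_word F = map tau_prime F"

text \<open>The result does not depend on which minimal factorization is chosen.\<close>

definition tau :: "nat \<Rightarrow> tangle \<Rightarrow> tangle" where
  "tau N X = compose_word N (tau_word (SOME F. minimal_factorization N X F))"

definition tau_length :: "nat \<Rightarrow> tangle \<Rightarrow> nat" where
  "tau_length N X = tangle_length N (tau N X)"

section \<open>Rewriting rules and the two assumptions\<close>

definition adjacent :: "nat \<Rightarrow> nat \<Rightarrow> bool" where
  "adjacent i j \<longleftrightarrow> i = j + 1 \<or> j = i + 1"

definition distant :: "nat \<Rightarrow> nat \<Rightarrow> bool" where
  "distant i j \<longleftrightarrow> i + 1 < j \<or> j + 1 < i"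

inductive delete_rule :: "word \<Rightarrow> word \<Rightarrow> bool" where
  "delete_rule [TP i, TP i] []"
| "delete_rule [UP i, UP i] [UP i]"
| "delete_rule [TP i, UP i] [UP i]"
| "delete_rule [UP i, TP i] [UP i]"
| "adjacent i j \<Longrightarrow> delete_rule [UP i, UP j, UP i] [UP i]"
| "adjacent i j \<Longrightarrow> delete_rule [UP i, TP j, UP i] [UP i]"
| "adjacent i j \<Longrightarrow> delete_rule [TP i, UP j, UP i] [TP j, UP i]"
| "adjacent i j \<Longrightarrow> delete_rule [UP i, UP j, TP i] [UP i, TP j]"
| "adjacent i j \<Longrightarrow> delete_rule [UP i, TP j, TP i] [UP i, UP j]"
| "adjacent i j \<Longrightarrow> delete_rule [TP i, TP j, UP i] [UP j, UP i]"

text \<open>\<open>adjacent\<close> and \<open>distant\<close> are symmetric, so the braid and swap rules can be applied in both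
  directions.\<close>

inductive braid_rule :: "word \<Rightarrow> word \<Rightarrow> bool" where
  "adjacent i j \<Longrightarrow> braid_rule [TP i, TP j, TP i] [TP j, TP i, TP j]"
| "adjacent i j \<Longrightarrow> braid_rule [TP i, UP j, TP i] [TP j, UP i, TP j]"

inductive swap_rule :: "word \<Rightarrow> word \<Rightarrow> bool" where
  "distant (prime_index p) (prime_index q) \<Longrightarrow> swap_rule [p, q] [q, p]"

definition rewrite_step :: "word \<Rightarrow> word \<Rightarrow> bool" where
  "rewrite_step F G \<longleftrightarrow> (\<exists>A L R B. F = A @ L @ B \<and> G = A @ R @ B \<and>
     (delete_rule L R \<or> braid_rule L R \<or> swap_rule L R))"

definition assumption1 :: bool where
  "assumption1 \<longleftrightarrow> (\<forall>N X F. X \<in> tangles N \<and> factorization N X F \<longrightarrow>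
     (\<exists>G. rewrite_step\<^sup>*\<^sup>* F G \<and> minimal_factorization N X G))"

definition count_TP :: "word \<Rightarrow> nat" where
  "count_TP F = length (filter is_TP F)"

definition assumption2 :: bool where
  "assumption2 \<longleftrightarrow> (\<forall>N. \<forall>X\<in>tangles N.
     (\<exists>F. minimal_factorization N X F \<and> count_TP F = crossings N X) \<and>
     (\<forall>F. factorization N X F \<longrightarrow> crossings N X \<le> count_TP F))"

section \<open>Machine model for the running time\<close>

text \<open>Structured random-access programs over registers and arrays of natural numbers, with
  unit cost per assignment, array write and test. The only arithmetic is adding or subtracting 1
  (besides constants occurring in the program). Hence all values are bounded by the largest
  number in the input and the program plus the number of steps, and unit cost is realistic.\<close>

datatype expr =
    Const nat
  | Reg nat
  | Incr nat
  | Decr nat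
  | Read nat nat \<comment> \<open>array, register holding the index\<close>

datatype test = Less nat nat | Equal nat nat

datatype prog =
    Skip
  | Assign nat expr
  | Write nat nat nat \<comment> \<open>array, register holding the index, register holding the value\<close>
  | Seq prog prog
  | Cond test prog prog
  | While test prog

type_synonym state = "(nat \<Rightarrow> nat) \<times> (nat \<Rightarrow> nat \<Rightarrow> nat)"

fun eval_expr :: "expr \<Rightarrow> state \<Rightarrow> nat" where
  "eval_expr (Const c) (r, m) = c"
| "eval_expr (Reg x) (r, m) = r x"
| "eval_expr (Incr x) (r, m) = r x + 1"
| "eval_expr (Decr x) (r, m) = r x - 1"
| "eval_expr (Read a x) (r, m) = m a (r x)"

fun eval_test :: "test \<Rightarrow> state \<Rightarrow> bool" where
  "eval_test (Less x y) (r, m) \<longleftrightarrow> r x < r y"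
| "eval_test (Equal x y) (r, m) \<longleftrightarrow> r x = r y"

text \<open>\<open>run c s t s'\<close>: started in state \<open>s\<close>, program \<open>c\<close> halts in state \<open>s'\<close> after \<open>t\<close> steps.\<close>

inductive run :: "prog \<Rightarrow> state \<Rightarrow> nat \<Rightarrow> state \<Rightarrow> bool" where
  run_Skip: "run Skip s 1 s"
| run_Assign: "run (Assign x e) (r, m) 1 (r(x := eval_expr e (r, m)), m)"
| run_Write: "run (Write a x y) (r, m) 1 (r, m(a := (m a)(r x := r y)))"
| run_Seq: "run c s t s' \<Longrightarrow> run d s' t' s'' \<Longrightarrow> run (Seq c d) s (t + t') s''"
| run_CondTrue: "eval_test b s \<Longrightarrow> run c s t s' \<Longrightarrow> run (Cond b c d) s (t + 1) s'"
| run_CondFalse: "\<not> eval_test b s \<Longrightarrow> run d s t s' \<Longrightarrow> run (Cond b c d) s (t + 1) s'"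
| run_WhileFalse: "\<not> eval_test b s \<Longrightarrow> run (While b c) s 1 s"
| run_WhileTrue: "eval_test b s \<Longrightarrow> run c s t s' \<Longrightarrow> run (While b c) s' t' s'' \<Longrightarrow>
    run (While b c) s (t + t' + 1) s''"

text \<open>Input: register 0 holds \<open>N\<close>, and array 0 holds, at the label of each node, the label of the
  node matched to it, where \<open>i\<close> has label \<open>i\<close> and \<open>i'\<close> has label \<open>N + i\<close>. Everything else is 0.\<close>

fun label :: "nat \<Rightarrow> node \<Rightarrow> nat" where
  "label N (Up i) = i"
| "label N (Low i) = N + i"

definition node_at :: "nat \<Rightarrow> nat \<Rightarrow> node" where
  "node_at N p = (if p \<le> N then Up p else Low (p - N))"

definition mate :: "tangle \<Rightarrow> node \<Rightarrow> node" where
  "mate X v = (THE w. w \<noteq> v \<and> {v, w} \<in> X)"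

definition input_state :: "nat \<Rightarrow> tangle \<Rightarrow> state" where
  "input_state N X =
     ((\<lambda>x. if x = 0 then N else 0),
      (\<lambda>a p. if a = 0 \<and> 1 \<le> p \<and> p \<le> 2 * N then label N (mate X (node_at N p)) else 0))"

text \<open>One program, working for all \<open>N\<close>, leaves the value in register 0 within the worst-case time
  bound \<open>f N\<close>.\<close>

definition computable_in_time_O :: "(nat \<Rightarrow> tangle \<Rightarrow> nat) \<Rightarrow> (nat \<Rightarrow> real) \<Rightarrow> bool" where
  "computable_in_time_O \<phi> g \<longleftrightarrow>
     (\<exists>c. \<exists>f :: nat \<Rightarrow> nat. (\<lambda>N. real (f N)) \<in> O(g) \<and>
       (\<forall>N. \<forall>X\<in>tangles N. \<exists>t s. run c (input_state N X) t s \<and> t \<le> f N \<and> fst s 0 = \<phi> N X))"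

end

(*
  For a tangle X let C(a,b) be the number of edges that leave the set {1..a} + {1'..b'} of nodes.
  A permutation is determined by this function, and it always satisfies C(a,b) >= |a - b|. The
  permutation tau(X) turns out to have the cut function max(|a - b|, C(a,b)).

  Lower bound on the length: multiplying by a prime raises C at most as much as the Demazure
  product of the corresponding T-word does, so C is dominated by the cut function of a permutation
  with at most as many inversions as the word has letters; domination is the Bruhat order.
  Upper bound: if X is not the identity, there are adjacent upper nodes i, i+1 whose edges lead
  to the right and (weakly) to the left. If they cross, T_i is split off; if they coincide in a cup,
  U_i is split off, where a suitable edge of X is cut open. Both lower max(|a - b|, C) in row i exactly
  as a descent of a permutation does. Hence tau(X) and its inversions can be read off from C, which is
  computed row by row.
*)
theory Submission
  imports Defs "HOL-Combinatorics.Permutations"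
begin

section \<open>Inversions of permutations\<close>

text \<open>Cups and caps can push the cut of a tangle below \<open>|a - b|\<close>, which no
  permutation allows; the maximum compensates for this. All comparisons are local: row
  \<open>Suc j\<close> of the cut function of a permutation is \<open>max - 1\<close> of its two
  neighbouring rows at an ascent and \<open>min + 1\<close> at a descent, so one letter of a word
  alters one row. Since \<open>tau\<close> picks an arbitrary minimal factorization, the equality
  case of the Bruhat comparison matters as much as the inequality: in a word of least length every
  letter is an ascent of the Demazure product, which is then the ordinary product and the same for
  all such words. The delicate point is splitting off \<open>U_i\<close>: opening an edge adds 2 to
  the cut of every region that has this edge on one side and the cup on the other. The edge must be
  chosen so that \<open>|a - b|\<close> hides all these increases outside one row; parity of cuts
  supplies the gap of 2 needed for that. Neighbouring cuts differ by 1, so the algorithm spends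
  constant time per pair \<open>(a, b)\<close>.\<close>

abbreviation adj_transp :: "nat \<Rightarrow> nat \<Rightarrow> nat" where
  "adj_transp j \<equiv> transpose (Suc j) (Suc (Suc j))"

text \<open>This is \<open>a + b - 2 r(a,b)\<close> with \<open>r\<close> the rank matrix of
  \<open>p\<close>, hence the number of edges leaving the region in the permutation diagram. Written
  as a path of +1 and -1 steps in \<open>a\<close>, it can be compared row by row.\<close>

definition csum :: "(nat \<Rightarrow> nat) \<Rightarrow> nat \<Rightarrow> nat \<Rightarrow> int" where
  "csum p a b = int b + (\<Sum>x=1..a. if p x \<le> b then -1 else 1)"

lemma csum_0 [simp]: "csum p 0 b = int b"
  by (simp add: csum_def)

lemma csum_Suc: "csum p (Suc a) b = csum p a b + (if p (Suc a) \<le> b then -1 else 1)"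
  by (simp add: csum_def)

lemma adj_transp_permutes: "Suc (Suc j) \<le> N \<Longrightarrow> adj_transp j permutes {1..N}"
  by (rule permutes_swap_id) auto

text \<open>A prefix other than \<open>{1..Suc j}\<close> contains both swapped positions or
  neither, so its summands are merely permuted.\<close>

lemma csum_transp:
  assumes "a \<noteq> Suc j"
  shows "csum (p \<circ> adj_transp j) a b = csum p a b"
proof (cases "a \<le> j")
  case True
  then have "(\<Sum>x=1..a. if (p \<circ> adj_transp j) x \<le> b then -1 else 1 :: int)
      = (\<Sum>x=1..a. if p x \<le> b then -1 else 1)"
    by (intro sum.cong) (auto simp: transpose_def)
  then show ?thesis by (simp add: csum_def)
next
  case False
  then have "adj_transp j permutes {1..a}"
    using assms by (intro adj_transp_permutes) auto
  from sum.permute[OF this, of "\<lambda>x. if p x \<le> b then -1 else 1 :: int"]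
  show ?thesis by (simp add: csum_def o_def)
qed

lemma csum_conv_card:
  "csum p a b = int a + int b - 2 * int (card {x \<in> {1..a}. p x \<le> b})"
proof (induction a)
  case (Suc a)
  have "{x \<in> {1..Suc a}. p x \<le> b} =
      (if p (Suc a) \<le> b then insert (Suc a) {x \<in> {1..a}. p x \<le> b} else {x \<in> {1..a}. p x \<le> b})"
    by (auto simp: le_Suc_eq)
  with Suc show ?case by (simp add: csum_Suc)
qed simp

text \<open>By injectivity at most \<open>min a b\<close> of the first \<open>a\<close> positions
  take values up to \<open>b\<close>.\<close>

lemma csum_ge_abs:
  assumes "p permutes {1..N}"
  shows "\<bar>int a - int b\<bar> \<le> csum p a b"
proof -
  let ?A = "{x \<in> {1..a}. p x \<le> b}"
  have ge1: "1 \<le> p x" if "1 \<le> x" for x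
  proof (cases "x \<in> {1..N}")
    case True
    then show ?thesis using permutes_in_image[OF assms, of x] by simp
  qed (use that permutes_not_in[OF assms, of x] in simp)
  have "p ` ?A \<subseteq> {1..b}" by (rule image_subsetI) (simp add: ge1[simplified])
  from card_mono[OF finite_atLeastAtMost this] have "card (p ` ?A) \<le> b" by simp
  moreover have "card (p ` ?A) = card ?A"
    using assms by (intro card_image) (meson inj_on_subset permutes_inj subset_UNIV)
  moreover have "card ?A \<le> a" using card_mono[of "{1..a}" ?A] by fastforce
  ultimately show ?thesis by (simp add: csum_conv_card)
qed

text \<open>The steps into and out of row \<open>Suc j\<close> cannot be +1 followed by -1, so the
  row is never a peak. Dually, at a descent it is never a valley.\<close>

lemma csum_ascent:
  assumes "p (Suc j) < p (Suc (Suc j))"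
  shows "csum p (Suc j) b = max (csum p j b) (csum p (Suc (Suc j)) b) - 1"
  using assms by (simp add: csum_Suc)

lemma csum_descent:
  assumes "p (Suc (Suc j)) < p (Suc j)"
  shows "csum p (Suc j) b = min (csum p j b) (csum p (Suc (Suc j)) b) + 1"
  using assms by (simp add: csum_Suc)

section \<open>Inversion numbers and adjacent transpositions\<close>

definition inversions :: "nat \<Rightarrow> (nat \<Rightarrow> nat) \<Rightarrow> (nat \<times> nat) set" where
  "inversions N p = {(x, y). 1 \<le> x \<and> x < y \<and> y \<le> N \<and> p y < p x}"

definition inv_count :: "nat \<Rightarrow> (nat \<Rightarrow> nat) \<Rightarrow> nat" where
  "inv_count N p = card (inversions N p)"

lemma finite_inversions: "finite (inversions N p)"
  by (rule finite_subset[of _ "{1..N} \<times> {1..N}"]) (auto simp: inversions_def)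

lemma inv_count_id [simp]: "inv_count N id = 0"
proof -
  have "inversions N id = {}" by (auto simp: inversions_def)
  then show ?thesis by (simp add: inv_count_def)
qed

lemma adj_transp_less:
  "x < y \<Longrightarrow> (x, y) \<noteq> (Suc j, Suc (Suc j)) \<Longrightarrow> adj_transp j x < adj_transp j y"
  by (auto simp: transpose_def)

lemma adj_transp_ge1: "1 \<le> x \<Longrightarrow> 1 \<le> adj_transp j x"
  by (simp add: transpose_def)

lemma adj_transp_le: "Suc (Suc j) \<le> N \<Longrightarrow> x \<le> N \<Longrightarrow> adj_transp j x \<le> N"
  by (simp add: transpose_def)

text \<open>Applying the transposition to both coordinates carries old inversions to new ones; only
  the swapped pair itself is added.\<close>

lemma inv_count_transp:
  assumes asc: "p (Suc j) < p (Suc (Suc j))" and N: "Suc (Suc j) \<le> N"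
  shows "inv_count N (p \<circ> adj_transp j) = Suc (inv_count N p)"
proof -
  let ?s = "adj_transp j" and ?f = "\<lambda>(x, y). (adj_transp j x, adj_transp j y)"
  have eq: "inversions N (p \<circ> ?s) = insert (Suc j, Suc (Suc j)) (?f ` inversions N p)" (is "?L = ?R")
  proof (intro equalityI subsetI)
    fix z assume z: "z \<in> ?L"
    obtain x y where xy: "z = (x, y)" by force
    show "z \<in> ?R"
    proof (cases "z = (Suc j, Suc (Suc j))")
      case False
      then have "(?s x, ?s y) \<in> inversions N p"
        using z adj_transp_less[of x y j] adj_transp_ge1[of x j] adj_transp_le[OF N, of y]
        unfolding xy by (simp add: inversions_def)
      then have "?f (?s x, ?s y) \<in> ?f ` inversions N p" by (rule imageI)
      then show ?thesis by (simp add: xy)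
    qed simp
  next
    fix z assume "z \<in> ?R"
    then consider "z = (Suc j, Suc (Suc j))" | x y where "(x, y) \<in> inversions N p" "z = (?s x, ?s y)"
      by auto
    then show "z \<in> ?L"
    proof cases
      case 1
      then show ?thesis using asc N by (simp add: inversions_def)
    next
      case 2
      then have "(x, y) \<noteq> (Suc j, Suc (Suc j))" using asc by (auto simp: inversions_def)
      then show ?thesis
        using 2 adj_transp_less[of x y j] adj_transp_ge1[of x j] adj_transp_le[OF N, of y]
        by (simp add: inversions_def)
    qed
  qed
  have "inj ?f"
    by (rule inj_on_inverseI[of _ ?f]) auto
  then have "card (?f ` inversions N p) = card (inversions N p)"
    by (metis card_image inj_on_subset subset_UNIV)
  moreover have "(Suc j, Suc (Suc j)) \<notin> ?f ` inversions N p"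
  proof
    assume "(Suc j, Suc (Suc j)) \<in> ?f ` inversions N p"
    then obtain x y where "(x, y) \<in> inversions N p" "?s x = Suc j" "?s y = Suc (Suc j)" by auto
    then have "x = Suc (Suc j)" "y = Suc j" by (metis transpose_apply_first transpose_apply_second transpose_involutory)+
    then show False using \<open>(x, y) \<in> inversions N p\<close> by (simp add: inversions_def)
  qed
  ultimately show ?thesis
    by (simp add: inv_count_def eq finite_inversions)
qed

lemma permutes_Suc_neq: "p permutes S \<Longrightarrow> p (Suc j) \<noteq> p (Suc (Suc j))"
  by (drule permutes_inj) (simp add: inj_eq)

lemma transp_transp: "p \<circ> adj_transp j \<circ> adj_transp j = p"
  by (simp add: comp_assoc)

lemma descent_split:
  assumes p: "p permutes {1..N}" and N: "Suc (Suc j) \<le> N"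
    and desc: "p (Suc (Suc j)) < p (Suc j)"
  obtains q where "q permutes {1..N}" "p = q \<circ> adj_transp j" "q (Suc j) < q (Suc (Suc j))"
    "inv_count N p = Suc (inv_count N q)"
proof
  let ?q = "p \<circ> adj_transp j"
  show "?q permutes {1..N}"
    using p adj_transp_permutes[OF N] by (rule permutes_compose[rotated])
  show eq: "p = ?q \<circ> adj_transp j" by (simp add: transp_transp)
  show asc: "?q (Suc j) < ?q (Suc (Suc j))" using desc by simp
  show "inv_count N p = Suc (inv_count N ?q)"
    using inv_count_transp[OF asc N] unfolding transp_transp .
qed

lemma csum_transp_ascent:
  assumes "p (Suc j) < p (Suc (Suc j))"
  shows "csum (p \<circ> adj_transp j) (Suc j) b = min (csum p j b) (csum p (Suc (Suc j)) b) + 1"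
  using csum_descent[of "p \<circ> adj_transp j" j b] assms
  by (simp add: csum_transp)

lemma no_descent_id:
  assumes p: "p permutes {1..N}"
    and asc: "\<And>j. Suc (Suc j) \<le> N \<Longrightarrow> p (Suc j) < p (Suc (Suc j))"
  shows "p = id"
proof (rule permutes_natset_ge[OF p])
  have "Suc x \<le> N \<Longrightarrow> Suc x \<le> p (Suc x)" for x
  proof (induction x)
    case 0
    then show ?case using p by (metis atLeastAtMost_iff le_refl One_nat_def permutes_in_image)
  next
    case (Suc x)
    then show ?case using asc[of x] by simp
  qed
  then show "\<forall>i\<in>{1..N}. i \<le> p i" by (metis One_nat_def Suc_le_D atLeastAtMost_iff)
qed

text \<open>On the diagonal \<open>csum\<close> is twice the number of values leaving
  \<open>{1..a}\<close>, so the hypothesis makes every initial segment invariant.\<close>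

lemma csum_diag_id:
  assumes p: "p permutes {1..N}" and le: "\<And>a. a \<le> N \<Longrightarrow> csum p a a \<le> 0"
  shows "p = id"
proof (rule permutes_natset_le[OF p], rule ballI)
  fix x assume x: "x \<in> {1..N}"
  let ?A = "{y \<in> {1..x}. p y \<le> x}"
  have "card {1..x} \<le> card ?A" using le[of x] x by (simp add: csum_conv_card)
  then have eq: "?A = {1..x}" by (intro card_seteq) auto
  have "x \<in> ?A" unfolding eq using x by simp
  then show "p x \<le> x" by simp
qed

text \<open>The hypothesis is the rank-matrix description of the Bruhat order.\<close>

lemma inv_count_mono:
  assumes "q permutes {1..N}" "p permutes {1..N}"
    and "\<And>a b. a \<le> N \<Longrightarrow> b \<le> N \<Longrightarrow> csum p a b \<le> csum q a b"
  shows "inv_count N p \<le> inv_count N q \<and> (inv_count N p = inv_count N q \<longrightarrow> p = q)"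
  using assms
proof (induction "inv_count N q" arbitrary: p q rule: less_induct)
  case less
  note q = less.prems(1) and p = less.prems(2) and le = less.prems(3)
  show ?case
  proof (cases "\<exists>j. Suc (Suc j) \<le> N \<and> q (Suc (Suc j)) < q (Suc j)")
    case False
    then have "q = id"
      using permutes_Suc_neq[OF q] by (intro no_descent_id[OF q]) (meson linorder_neqE_nat)
    moreover have "p = id"
    proof (rule csum_diag_id[OF p])
      fix a assume "a \<le> N"
      have "{x \<in> {1..a}. id x \<le> a} = {1..a}" by auto
      then have "csum id a a = 0" by (simp only: csum_conv_card) simp
      then show "csum p a a \<le> 0" using le[of a a] \<open>a \<le> N\<close> \<open>q = id\<close> by simp
    qed
    ultimately show ?thesis by simp
  next
    case True
    then obtain j where j: "Suc (Suc j) \<le> N" and qd: "q (Suc (Suc j)) < q (Suc j)" by blast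
    obtain q' where q': "q' permutes {1..N}" "q = q' \<circ> adj_transp j"
        "q' (Suc j) < q' (Suc (Suc j))" "inv_count N q = Suc (inv_count N q')"
      using descent_split[OF q j qd] .
    have q'_eq: "csum q' a b = csum q a b" if "a \<noteq> Suc j" for a b
      using that by (simp add: q'(2) csum_transp)
    show ?thesis
    proof (cases "p (Suc (Suc j)) < p (Suc j)")
      case True
      obtain p' where p': "p' permutes {1..N}" "p = p' \<circ> adj_transp j"
          "p' (Suc j) < p' (Suc (Suc j))" "inv_count N p = Suc (inv_count N p')"
        using descent_split[OF p j True] .
      have p'_eq: "csum p' a b = csum p a b" if "a \<noteq> Suc j" for a b
        using that by (simp add: p'(2) csum_transp)
      \<comment> \<open>Removing the descent from both sides changes only row \<open>Suc j\<close>,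
        where the ascent formula is monotone in the two neighbouring rows.\<close>
      have "csum p' a b \<le> csum q' a b" if ab: "a \<le> N" "b \<le> N" for a b
      proof (cases "a = Suc j")
        case True
        have "csum p j b \<le> csum q j b" "csum p (Suc (Suc j)) b \<le> csum q (Suc (Suc j)) b"
          using le ab j by simp_all
        then show ?thesis
          using csum_ascent[OF p'(3), of b] csum_ascent[OF q'(3), of b] True
          by (simp add: p'_eq q'_eq)
      qed (use le ab in \<open>simp add: p'_eq q'_eq\<close>)
      then have "inv_count N p' \<le> inv_count N q' \<and> (inv_count N p' = inv_count N q' \<longrightarrow> p' = q')"
        using less.hyps[of q' p'] q' p' by simp
      then show ?thesis using p' q' by auto
    next
      case False
      then have asc: "p (Suc j) < p (Suc (Suc j))"
        using permutes_Suc_neq[OF p] by (metis linorder_neqE_nat)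
      \<comment> \<open>Here \<open>p\<close> has an ascent already, so the same formula puts it
        below the shorter \<open>q'\<close>; the inequality of lengths is then strict.\<close>
      have "csum p a b \<le> csum q' a b" if ab: "a \<le> N" "b \<le> N" for a b
      proof (cases "a = Suc j")
        case True
        have "csum p j b \<le> csum q j b" "csum p (Suc (Suc j)) b \<le> csum q (Suc (Suc j)) b"
          using le ab j by simp_all
        then show ?thesis
          using csum_ascent[OF asc, of b] csum_ascent[OF q'(3), of b] True
          by (simp add: q'_eq)
      qed (use le ab in \<open>simp add: q'_eq\<close>)
      then have "inv_count N p \<le> inv_count N q'"
        using less.hyps[of q' p] q' p by simp
      then show ?thesis using q' by simp
    qed
  qed
qed

section \<open>Tangles as matchings\<close>

text \<open>Working with involutions turns composition with a prime into a formula on functions.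
  Values outside \<open>nodes N\<close> are unconstrained.\<close>

definition matching :: "nat \<Rightarrow> (node \<Rightarrow> node) \<Rightarrow> bool" where
  "matching N m \<longleftrightarrow> (\<forall>v\<in>nodes N. m v \<in> nodes N \<and> m v \<noteq> v \<and> m (m v) = v)"

definition tangle_of :: "nat \<Rightarrow> (node \<Rightarrow> node) \<Rightarrow> tangle" where
  "tangle_of N m = (\<lambda>v. {v, m v}) ` nodes N"

lemma matchingD:
  assumes "matching N m" "v \<in> nodes N"
  shows "m v \<in> nodes N" "m v \<noteq> v" "m (m v) = v"
  using assms by (auto simp: matching_def)

lemma Up_in_nodes [simp]: "Up k \<in> nodes N \<longleftrightarrow> 1 \<le> k \<and> k \<le> N"
  by (auto simp: nodes_def)

lemma Low_in_nodes [simp]: "Low k \<in> nodes N \<longleftrightarrow> 1 \<le> k \<and> k \<le> N"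
  by (auto simp: nodes_def)

lemma finite_nodes [simp]: "finite (nodes N)"
  by (simp add: nodes_def)

lemma edge_in_tangle_of:
  assumes "matching N m"
  shows "{a, b} \<in> tangle_of N m \<longleftrightarrow> a \<in> nodes N \<and> b = m a"
proof
  assume "{a, b} \<in> tangle_of N m"
  then obtain v where "v \<in> nodes N" "{a, b} = {v, m v}" by (auto simp: tangle_of_def)
  then show "a \<in> nodes N \<and> b = m a"
    using matchingD[OF assms, of v] by (auto simp: doubleton_eq_iff)
qed (auto simp: tangle_of_def)

lemma tangle_of_cong:
  "(\<And>v. v \<in> nodes N \<Longrightarrow> m v = m' v) \<Longrightarrow> tangle_of N m = tangle_of N m'"
  by (auto simp: tangle_of_def)

lemma tangle_of_in_tangles:
  assumes "matching N m"
  shows "tangle_of N m \<in> tangles N"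
proof -
  have "e \<subseteq> nodes N \<and> card e = 2" if "e \<in> tangle_of N m" for e
    using that matchingD[OF assms] by (auto simp: tangle_of_def card_2_iff)
  moreover have "\<exists>!e. e \<in> tangle_of N m \<and> v \<in> e" if v: "v \<in> nodes N" for v
  proof (rule ex1I[of _ "{v, m v}"])
    show "{v, m v} \<in> tangle_of N m \<and> v \<in> {v, m v}" using v by (auto simp: tangle_of_def)
    fix e assume e: "e \<in> tangle_of N m \<and> v \<in> e"
    then obtain u where "u \<in> nodes N" "e = {u, m u}" by (auto simp: tangle_of_def)
    then show "e = {v, m v}" using e matchingD[OF assms, of u] by auto
  qed
  ultimately show ?thesis by (simp add: tangles_def)
qed

lemma mate_tangle_of:
  assumes "matching N m" "v \<in> nodes N"
  shows "mate (tangle_of N m) v = m v"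
  unfolding mate_def edge_in_tangle_of[OF assms(1)]
  using assms(2) matchingD(2)[OF assms] by blast

lemma edge_tangle:
  assumes X: "X \<in> tangles N" and v: "v \<in> nodes N"
  shows "mate X v \<noteq> v" "{v, mate X v} \<in> X" "mate X v \<in> nodes N"
    "\<And>w. w \<noteq> v \<Longrightarrow> {v, w} \<in> X \<Longrightarrow> mate X v = w"
proof -
  have edge: "e \<subseteq> nodes N \<and> card e = 2" if "e \<in> X" for e
    using X that by (auto simp: tangles_def)
  have ex1: "\<exists>!e. e \<in> X \<and> v \<in> e" using X v by (auto simp: tangles_def)
  then obtain e where e: "e \<in> X" "v \<in> e" by blast
  then obtain p q where pq: "e = {p, q}" "p \<noteq> q" using edge[of e] by (auto simp: card_2_iff)
  define w where "w = (if v = p then q else p)"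
  have w: "w \<noteq> v" "{v, w} \<in> X"
    using e pq by (auto simp: w_def insert_commute)
  have uniq: "w' = w" if "w' \<noteq> v" "{v, w'} \<in> X" for w'
    using ex1 w that by (metis doubleton_eq_iff insertI1)
  have "mate X v = w" unfolding mate_def using w uniq by blast
  then show "mate X v \<noteq> v" "{v, mate X v} \<in> X" "mate X v \<in> nodes N"
    "\<And>w. w \<noteq> v \<Longrightarrow> {v, w} \<in> X \<Longrightarrow> mate X v = w"
    using w uniq edge[OF w(2)] by blast+
qed

lemma matching_mate:
  assumes X: "X \<in> tangles N"
  shows "matching N (mate X)"
  unfolding matching_def
proof (intro ballI conjI)
  fix v assume v: "v \<in> nodes N"
  note * = edge_tangle[OF X v]
  show "mate X v \<in> nodes N" by (rule *(3))
  show "mate X v \<noteq> v" by (rule *(1))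
  show "mate X (mate X v) = v"
    using edge_tangle(4)[OF X *(3), of v] *(1,2) by (simp add: insert_commute)
qed

lemma tangle_of_mate:
  assumes X: "X \<in> tangles N"
  shows "tangle_of N (mate X) = X"
proof (intro equalityI subsetI)
  fix e assume e: "e \<in> X"
  then have "e \<subseteq> nodes N" "card e = 2" using X by (auto simp: tangles_def)
  then obtain v w where "e = {v, w}" "v \<noteq> w" "v \<in> nodes N" by (auto simp: card_2_iff)
  then show "e \<in> tangle_of N (mate X)"
    using edge_tangle(4)[OF X, of v w] e by (auto simp: tangle_of_def)
qed (use edge_tangle(2)[OF X] in \<open>auto simp: tangle_of_def\<close>)

section \<open>Left multiplication by a prime\<close>

fun flip :: "node \<Rightarrow> node" where
  "flip (Up k) = Low k"
| "flip (Low k) = Up k"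

abbreviation up_transp :: "nat \<Rightarrow> node \<Rightarrow> node" where
  "up_transp j \<equiv> transpose (Up (Suc j)) (Up (Suc (Suc j)))"

definition T_act :: "nat \<Rightarrow> (node \<Rightarrow> node) \<Rightarrow> node \<Rightarrow> node" where
  "T_act j m v = up_transp j (m (up_transp j v))"

text \<open>The former partners of the two nodes get joined. If the two nodes were partners of each
  other, the new cup takes the place of the old one, which closes up into a discarded loop.\<close>

definition U_act :: "nat \<Rightarrow> (node \<Rightarrow> node) \<Rightarrow> node \<Rightarrow> node" where
  "U_act j m v = (let x = Up (Suc j); y = Up (Suc (Suc j)) in
     if v = x then y else if v = y then x
     else if m v = x then m y else if m v = y then m x else m v)"

lemma matching_flip: "matching N flip"
  by (auto simp: matching_def nodes_def)

lemma up_transp_nodes: "Suc (Suc j) \<le> N \<Longrightarrow> up_transp j v \<in> nodes N \<longleftrightarrow> v \<in> nodes N"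
  by (auto simp: transpose_def)

lemma matching_T_act:
  assumes "matching N m" "Suc (Suc j) \<le> N"
  shows "matching N (T_act j m)"
  unfolding matching_def
proof (intro ballI conjI)
  fix v assume "v \<in> nodes N"
  then have "up_transp j v \<in> nodes N" using assms by (simp add: up_transp_nodes)
  from matchingD[OF assms(1) this] assms(2)
  show "T_act j m v \<in> nodes N" "T_act j m (T_act j m v) = v"
    by (auto simp: T_act_def up_transp_nodes)
  show "T_act j m v \<noteq> v"
    unfolding T_act_def using \<open>m (up_transp j v) \<noteq> up_transp j v\<close> by (metis transpose_involutory)
qed

lemma matching_U_act:
  assumes "matching N m" "Suc (Suc j) \<le> N"
  shows "matching N (U_act j m)"
  unfolding matching_def
proof (intro ballI)
  fix v assume v: "v \<in> nodes N"
  define x y where xy: "x = Up (Suc j)" "y = Up (Suc (Suc j))"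
  have "x \<in> nodes N" "y \<in> nodes N" "x \<noteq> y" using assms by (auto simp: xy)
  then show "U_act j m v \<in> nodes N \<and> U_act j m v \<noteq> v \<and> U_act j m (U_act j m v) = v"
    using matchingD[OF assms(1) v] matchingD[OF assms(1), of x] matchingD[OF assms(1), of y]
    unfolding U_act_def Let_def xy[symmetric] by (smt (verit))
qed

lemma id_tangle_eq: "id_tangle N = tangle_of N flip"
proof (intro equalityI subsetI)
  fix e assume "e \<in> id_tangle N"
  then obtain i where "e = {Up i, flip (Up i)}" "Up i \<in> nodes N" by (auto simp: id_tangle_def)
  then show "e \<in> tangle_of N flip" by (auto simp: tangle_of_def)
next
  fix e assume "e \<in> tangle_of N flip"
  then obtain i where "1 \<le> i" "i \<le> N" "e = {Up i, Low i}"
    by (auto simp: tangle_of_def nodes_def insert_commute)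
  then show "e \<in> id_tangle N" by (auto simp: id_tangle_def)
qed

lemma id_tangle_minus:
  "e \<in> id_tangle N - {{Up i, Low i}, {Up k, Low k}} \<longleftrightarrow>
    (\<exists>l. 1 \<le> l \<and> l \<le> N \<and> l \<noteq> i \<and> l \<noteq> k \<and> e = {Up l, Low l})"
proof -
  have "{Up a, Low a} = {Up b, Low b} \<longleftrightarrow> a = b" for a b
    by (auto simp: doubleton_eq_iff)
  then show ?thesis unfolding id_tangle_def by auto
qed

lemma prime_tangle_T:
  assumes "Suc (Suc j) \<le> N"
  shows "prime_tangle N (TP (Suc j)) = tangle_of N (T_act j flip)"
proof (rule set_eqI)
  fix e
  let ?i = "Suc j" and ?k = "Suc (Suc j)"
  have "e \<in> tangle_of N (T_act j flip) \<longleftrightarrow>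
      (\<exists>k. 1 \<le> k \<and> k \<le> N \<and> e = {Up k, Low (adj_transp j k)})"
  proof
    assume "e \<in> tangle_of N (T_act j flip)"
    then obtain v where v: "v \<in> nodes N" "e = {v, T_act j flip v}" by (auto simp: tangle_of_def)
    show "\<exists>k. 1 \<le> k \<and> k \<le> N \<and> e = {Up k, Low (adj_transp j k)}"
    proof (cases v)
      case (Up k)
      then show ?thesis using v by (intro exI[of _ k]) (auto simp: T_act_def transpose_def)
    next
      case (Low k)
      then show ?thesis
        using v assms by (intro exI[of _ "adj_transp j k"]) (auto simp: T_act_def transpose_def)
    qed
  next
    assume "\<exists>k. 1 \<le> k \<and> k \<le> N \<and> e = {Up k, Low (adj_transp j k)}"
    then obtain k where "1 \<le> k" "k \<le> N" "e = {Up k, Low (adj_transp j k)}" by blast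
    then have "e = {Up k, T_act j flip (Up k)}" "Up k \<in> nodes N"
      by (auto simp: T_act_def transpose_def)
    then show "e \<in> tangle_of N (T_act j flip)" by (auto simp: tangle_of_def)
  qed
  moreover have "e \<in> prime_tangle N (TP ?i) \<longleftrightarrow>
      (\<exists>k. 1 \<le> k \<and> k \<le> N \<and> k \<noteq> ?i \<and> k \<noteq> ?k \<and> e = {Up k, Low k}) \<or>
      e = {Up ?i, Low ?k} \<or> e = {Up ?k, Low ?i}"
    unfolding prime_tangle.simps Un_iff insert_iff empty_iff Suc_eq_plus1[symmetric] id_tangle_minus
    by simp
  moreover have "(\<exists>k. 1 \<le> k \<and> k \<le> N \<and> e = {Up k, Low (adj_transp j k)}) \<longleftrightarrow>
      (\<exists>k. 1 \<le> k \<and> k \<le> N \<and> k \<noteq> ?i \<and> k \<noteq> ?k \<and> e = {Up k, Low k}) \<or>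
      e = {Up ?i, Low ?k} \<or> e = {Up ?k, Low ?i}" (is "?l \<longleftrightarrow> ?r")
  proof
    assume ?l
    then obtain k where "1 \<le> k" "k \<le> N" "e = {Up k, Low (adj_transp j k)}" by blast
    then show ?r by (cases "k = ?i"; cases "k = ?k") auto
  next
    assume ?r
    then consider k where "1 \<le> k" "k \<le> N" "k \<noteq> ?i" "k \<noteq> ?k" "e = {Up k, Low k}"
      | "e = {Up ?i, Low ?k}" | "e = {Up ?k, Low ?i}" by blast
    then show ?l
    proof cases
      case 1
      then show ?thesis by (intro exI[of _ k]) simp
    next
      case 2
      then show ?thesis using assms by (intro exI[of _ ?i]) simp
    next
      case 3
      then show ?thesis using assms by (intro exI[of _ ?k]) simp
    qed
  qed
  ultimately show "e \<in> prime_tangle N (TP ?i) \<longleftrightarrow> e \<in> tangle_of N (T_act j flip)" by simp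
qed

lemma prime_tangle_U:
  assumes "Suc (Suc j) \<le> N"
  shows "prime_tangle N (UP (Suc j)) = tangle_of N (U_act j flip)"
proof (rule set_eqI)
  fix e
  let ?i = "Suc j" and ?k = "Suc (Suc j)"
  have "e \<in> prime_tangle N (UP ?i) \<longleftrightarrow>
      (\<exists>k. 1 \<le> k \<and> k \<le> N \<and> k \<noteq> ?i \<and> k \<noteq> ?k \<and> e = {Up k, Low k}) \<or>
      e = {Up ?i, Up ?k} \<or> e = {Low ?i, Low ?k}"
    unfolding prime_tangle.simps Un_iff insert_iff empty_iff Suc_eq_plus1[symmetric] id_tangle_minus
    by simp
  moreover have "e \<in> tangle_of N (U_act j flip) \<longleftrightarrow>
      (\<exists>k. 1 \<le> k \<and> k \<le> N \<and> k \<noteq> ?i \<and> k \<noteq> ?k \<and> e = {Up k, Low k}) \<or>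
      e = {Up ?i, Up ?k} \<or> e = {Low ?i, Low ?k}" (is "_ \<longleftrightarrow> ?r")
  proof
    assume "e \<in> tangle_of N (U_act j flip)"
    then obtain v where v: "v \<in> nodes N" "e = {v, U_act j flip v}" by (auto simp: tangle_of_def)
    show ?r
    proof (cases v)
      case (Up k)
      then show ?thesis
        using v by (cases "k = ?i"; cases "k = ?k") (auto simp: U_act_def insert_commute)
    next
      case (Low k)
      then show ?thesis
        using v by (cases "k = ?i"; cases "k = ?k") (auto simp: U_act_def insert_commute)
    qed
  next
    assume ?r
    then consider k where "1 \<le> k" "k \<le> N" "k \<noteq> ?i" "k \<noteq> ?k" "e = {Up k, Low k}"
      | "e = {Up ?i, Up ?k}" | "e = {Low ?i, Low ?k}" by blast
    then obtain v where "v \<in> nodes N" "e = {v, U_act j flip v}"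
    proof cases
      case 1
      then show ?thesis using that[of "Up k"] by (simp add: U_act_def)
    next
      case 2
      then show ?thesis using that[of "Up ?i"] assms by (simp add: U_act_def)
    next
      case 3
      then show ?thesis using that[of "Low ?i"] assms by (simp add: U_act_def)
    qed
    then show "e \<in> tangle_of N (U_act j flip)" by (auto simp: tangle_of_def)
  qed
  ultimately show "e \<in> prime_tangle N (UP ?i) \<longleftrightarrow> e \<in> tangle_of N (U_act j flip)" by simp
qed

lemma stack_adj_tangle_of:
  assumes "matching N p" "matching N m"
  shows "stack_adj (tangle_of N p) (tangle_of N m) =
    {(in_upper v, in_upper (p v)) | v. v \<in> nodes N} \<union> {(in_lower v, in_lower (m v)) | v. v \<in> nodes N}"
proof -
  have "a \<noteq> b \<and> {a, b} \<in> tangle_of N f \<longleftrightarrow> a \<in> nodes N \<and> b = f a" if "matching N f" for a b f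
    using that by (metis edge_in_tangle_of matchingD(2))
  then show ?thesis using assms unfolding stack_adj_def by auto
qed

text \<open>The labelling \<open>k\<close> is constant on the components of the stacked diagram and separates the
  edges of the claimed composite.\<close>

lemma tangle_comp_eqI:
  assumes m: "matching N m"
    and path: "\<And>v. v \<in> nodes N \<Longrightarrow> (outer v, outer (m v)) \<in> (stack_adj P Y)\<^sup>*"
    and const: "\<And>s t. (s, t) \<in> stack_adj P Y \<Longrightarrow> k s = k t"
    and lab: "\<And>v. k (outer v) = (if v \<in> nodes N then {v, m v} else {v})"
  shows "tangle_comp P Y = tangle_of N m"
proof (intro equalityI subsetI)
  fix e assume "e \<in> tangle_comp P Y"
  then obtain a b where ab: "e = {a, b}" "a \<noteq> b" "(outer a, outer b) \<in> (stack_adj P Y)\<^sup>*"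
    by (auto simp: tangle_comp_def)
  from ab(3) have "k (outer a) = k (outer b)"
    by (induction rule: rtrancl_induct) (auto dest: const)
  then show "e \<in> tangle_of N m"
    using ab(1,2) by (auto simp: lab tangle_of_def doubleton_eq_iff split: if_splits)
next
  fix e assume "e \<in> tangle_of N m"
  then obtain v where "v \<in> nodes N" "e = {v, m v}" by (auto simp: tangle_of_def)
  then show "e \<in> tangle_comp P Y"
    using path[of v] matchingD(2)[OF m, of v] unfolding tangle_comp_def mem_Collect_eq
    by (intro exI[of _ v] exI[of _ "m v"]) simp
qed

lemma tangle_comp_T:
  assumes m: "matching N m" and j: "Suc (Suc j) \<le> N"
  shows "tangle_comp (prime_tangle N (TP (Suc j))) (tangle_of N m) = tangle_of N (T_act j m)"
proof -
  let ?s = "up_transp j"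
  define E where "E = stack_adj (prime_tangle N (TP (Suc j))) (tangle_of N m)"
  have E: "E = {(in_upper v, in_upper (T_act j flip v)) | v. v \<in> nodes N} \<union>
      {(in_lower v, in_lower (m v)) | v. v \<in> nodes N}"
    unfolding E_def prime_tangle_T[OF j]
    by (rule stack_adj_tangle_of[OF matching_T_act[OF matching_flip j] m])
  have m': "matching N (T_act j m)" by (rule matching_T_act[OF m j])
  have down: "(outer v, in_lower (?s v)) \<in> E\<^sup>*" if "v \<in> nodes N" for v
  proof (cases v)
    case (Up k)
    have "(outer v, in_lower (?s v)) = (in_upper v, in_upper (T_act j flip v))"
      by (simp add: Up T_act_def transpose_def)
    then show ?thesis using that unfolding E by blast
  qed (simp add: transpose_def)
  have up: "(in_lower v, outer (?s v)) \<in> E\<^sup>*" if "v \<in> nodes N" for v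
  proof (cases v)
    case (Up k)
    have "(in_lower v, outer (?s v)) = (in_upper (Low k), in_upper (T_act j flip (Low k)))"
      by (simp add: Up T_act_def transpose_def)
    moreover have "Low k \<in> nodes N" using that Up by simp
    ultimately show ?thesis unfolding E by blast
  qed (simp add: transpose_def)
  define lab where "lab v = (if v \<in> nodes N then {v, T_act j m v} else {v})" for v
  have lab_eq: "lab (T_act j m v) = lab v" if "v \<in> nodes N" for v
    using matchingD[OF m' that] that by (auto simp: lab_def)
  \<comment> \<open>A middle node inherits the label of the outer node to which the prime connects
    it.\<close>
  define k where "k s = (case s of Top i \<Rightarrow> lab (Up i) | Mid i \<Rightarrow> lab (?s (Up i)) | Bot i \<Rightarrow> lab (Low i))" for s
  have k_lower: "k (in_lower v) = lab (?s v)" for v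
    by (cases v) (simp_all add: k_def transpose_def)
  show ?thesis
  proof (rule tangle_comp_eqI[OF m', of "prime_tangle N (TP (Suc j))" "tangle_of N m" k, folded E_def])
    fix v assume v: "v \<in> nodes N"
    then have sv: "?s v \<in> nodes N" using j by (simp add: up_transp_nodes)
    then have "(in_lower (?s v), in_lower (m (?s v))) \<in> E" unfolding E by blast
    with down[OF v] up[OF matchingD(1)[OF m sv]]
    show "(outer v, outer (T_act j m v)) \<in> E\<^sup>*" by (simp add: T_act_def)
  next
    fix s t assume "(s, t) \<in> E"
    then consider v where "v \<in> nodes N" "s = in_upper v" "t = in_upper (T_act j flip v)"
      | v where "v \<in> nodes N" "s = in_lower v" "t = in_lower (m v)" unfolding E by blast
    then show "k s = k t"
    proof cases
      case 1
      then show ?thesis by (cases v) (auto simp: k_def T_act_def transpose_def)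
    next
      case 2
      then have "?s v \<in> nodes N" using j by (simp add: up_transp_nodes)
      from lab_eq[OF this] have "lab (?s (m v)) = lab (?s v)" by (simp add: T_act_def)
      then show ?thesis by (simp add: 2 k_lower)
    qed
  next
    fix v show "k (outer v) = (if v \<in> nodes N then {v, T_act j m v} else {v})"
      by (cases v) (simp_all add: k_def lab_def)
  qed
qed

lemma tangle_comp_U:
  assumes m: "matching N m" and j: "Suc (Suc j) \<le> N"
  shows "tangle_comp (prime_tangle N (UP (Suc j))) (tangle_of N m) = tangle_of N (U_act j m)"
proof -
  define x y where xy: "x = Up (Suc j)" "y = Up (Suc (Suc j))"
  define E where "E = stack_adj (prime_tangle N (UP (Suc j))) (tangle_of N m)"
  have E: "E = {(in_upper v, in_upper (U_act j flip v)) | v. v \<in> nodes N} \<union>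
      {(in_lower v, in_lower (m v)) | v. v \<in> nodes N}"
    unfolding E_def prime_tangle_U[OF j]
    by (rule stack_adj_tangle_of[OF matching_U_act[OF matching_flip j] m])
  have m': "matching N (U_act j m)" by (rule matching_U_act[OF m j])
  have xy_nodes: "x \<in> nodes N" "y \<in> nodes N" "x \<noteq> y" using j by (auto simp: xy)
  note mx = matchingD[OF m xy_nodes(1)] and my = matchingD[OF m xy_nodes(2)]
  have Uval: "U_act j m v = (if v = x then y else if v = y then x
      else if m v = x then m y else if m v = y then m x else m v)" for v
    by (simp add: U_act_def Let_def xy)
  have edgeI: "(in_upper v, in_upper (U_act j flip v)) \<in> E" "(in_lower v, in_lower (m v)) \<in> E"
    if "v \<in> nodes N" for v
    using that unfolding E by blast+
  have down: "(outer v, in_lower v) \<in> E\<^sup>*" if "v \<in> nodes N" "v \<noteq> x" "v \<noteq> y" for v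
  proof (cases v)
    case (Up k)
    then have "(outer v, in_lower v) = (in_upper v, in_upper (U_act j flip v))"
      using that by (auto simp: U_act_def xy)
    then show ?thesis using edgeI(1)[OF that(1)] by auto
  qed simp
  have up: "(in_lower v, outer v) \<in> E\<^sup>*" if "v \<in> nodes N" "v \<noteq> x" "v \<noteq> y" for v
  proof (cases v)
    case (Up k)
    then have "(in_lower v, outer v) = (in_upper (Low k), in_upper (U_act j flip (Low k)))"
      using that by (auto simp: U_act_def xy)
    moreover have "Low k \<in> nodes N" using that Up by simp
    ultimately show ?thesis by (metis edgeI(1) r_into_rtrancl)
  qed simp
  have top: "(outer x, outer y) \<in> E" "(outer y, outer x) \<in> E"
    using edgeI(1)[OF xy_nodes(1)] edgeI(1)[OF xy_nodes(2)] by (auto simp: U_act_def xy)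
  have mid: "(in_lower x, in_lower y) \<in> E" "(in_lower y, in_lower x) \<in> E"
    using edgeI(1)[of "Low (Suc j)"] edgeI(1)[of "Low (Suc (Suc j))"] j
    by (auto simp: U_act_def xy)
  define lab where "lab v = (if v \<in> nodes N then {v, U_act j m v} else {v})" for v
  have lab_eq: "lab (U_act j m v) = lab v" if "v \<in> nodes N" for v
    using matchingD[OF m' that] that by (auto simp: lab_def)
  \<comment> \<open>The two middle nodes joined by the prime lie on the path between
    \<open>m x\<close> and \<open>m y\<close> and get the label of that edge. If
    \<open>m x = y\<close> they form an internal loop without outer nodes, labelled
    \<open>{}\<close>.\<close>
  define h where "h v = (if v = x \<or> v = y then (if m x = y then {} else lab (m v)) else lab v)" for v
  define k where "k s = (case s of Top i \<Rightarrow> lab (Up i) | Mid i \<Rightarrow> h (Up i) | Bot i \<Rightarrow> lab (Low i))" for s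
  have k_lower: "k (in_lower v) = h v" for v
    by (cases v) (auto simp: k_def h_def xy)
  have hxy: "h x = h y"
  proof (cases "m x = y")
    case False
    then have "U_act j m (m x) = m y" using mx my xy_nodes(3) by (auto simp: Uval)
    then show ?thesis using lab_eq[OF mx(1)] False by (simp add: h_def)
  qed (simp add: h_def)
  show ?thesis
  proof (rule tangle_comp_eqI[OF m', of "prime_tangle N (UP (Suc j))" "tangle_of N m" k, folded E_def])
    fix v assume v: "v \<in> nodes N"
    note mv = matchingD[OF m v]
    consider "v = x" | "v = y" | "v \<noteq> x" "v \<noteq> y" "m v = x" | "v \<noteq> x" "v \<noteq> y" "m v = y"
      | "v \<noteq> x" "v \<noteq> y" "m v \<noteq> x" "m v \<noteq> y" by blast
    then show "(outer v, outer (U_act j m v)) \<in> E\<^sup>*"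
    proof cases
      case 3
      then have "m y \<noteq> x" "m y \<noteq> y" using mv my by auto
      then have "(in_lower (m y), outer (m y)) \<in> E\<^sup>*" using up my by simp
      with down[OF v 3(1,2)] edgeI(2)[OF v] mid(1) edgeI(2)[OF xy_nodes(2)] 3
      show ?thesis by (simp add: Uval)
    next
      case 4
      then have "m x \<noteq> x" "m x \<noteq> y" using mv mx by auto
      then have "(in_lower (m x), outer (m x)) \<in> E\<^sup>*" using up mx by simp
      with down[OF v 4(1,2)] edgeI(2)[OF v] mid(2) edgeI(2)[OF xy_nodes(1)] 4 xy_nodes(3)
      show ?thesis by (simp add: Uval)
    next
      case 5
      with down[OF v 5(1,2)] edgeI(2)[OF v] up[OF mv(1) 5(3,4)]
      show ?thesis by (simp add: Uval)
    qed (use top xy_nodes(3) in \<open>auto simp: Uval\<close>)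
  next
    fix s t assume "(s, t) \<in> E"
    then consider v where "v \<in> nodes N" "s = in_upper v" "t = in_upper (U_act j flip v)"
      | v where "v \<in> nodes N" "s = in_lower v" "t = in_lower (m v)" unfolding E by blast
    then show "k s = k t"
    proof cases
      case 1
      have "lab x = lab y" using lab_eq[OF xy_nodes(1)] by (simp add: Uval)
      then have "lab (Up (Suc j)) = lab (Up (Suc (Suc j)))" "h (Up (Suc j)) = h (Up (Suc (Suc j)))"
        using hxy by (simp_all add: xy)
      moreover have "h (Up i) = lab (Up i)" if "i \<noteq> Suc j" "i \<noteq> Suc (Suc j)" for i
        using that by (simp add: h_def xy)
      ultimately show ?thesis
        using 1 by (cases v) (auto simp: k_def U_act_def Let_def)
    next
      case 2
      note mv = matchingD[OF m 2(1)]
      consider "v = x" | "v = y" | "v \<noteq> x" "v \<noteq> y" "m v = x" | "v \<noteq> x" "v \<noteq> y" "m v = y"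
        | "v \<noteq> x" "v \<noteq> y" "m v \<noteq> x" "m v \<noteq> y" by blast
      then have "h v = h (m v)"
      proof cases
        case 5
        then show ?thesis using lab_eq[OF 2(1)] by (simp add: h_def Uval)
      qed (use mv mx my xy_nodes(3) in \<open>auto simp: h_def\<close>)
      then show ?thesis by (simp add: 2 k_lower)
    qed
  next
    fix v show "k (outer v) = (if v \<in> nodes N then {v, U_act j m v} else {v})"
      by (cases v) (simp_all add: k_def lab_def)
  qed
qed

section \<open>Cuts\<close>

definition region :: "nat \<Rightarrow> nat \<Rightarrow> node set" where
  "region a b = Up ` {1..a} \<union> Low ` {1..b}"

definition cut :: "(node \<Rightarrow> node) \<Rightarrow> node set \<Rightarrow> int" where
  "cut m S = int (card {v \<in> S. m v \<notin> S})"

definition sep :: "node set \<Rightarrow> node \<Rightarrow> node \<Rightarrow> int" where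
  "sep S u v = (if (u \<in> S) = (v \<in> S) then 0 else 1)"

lemma Up_in_region [simp]: "Up k \<in> region a b \<longleftrightarrow> 1 \<le> k \<and> k \<le> a"
  by (auto simp: region_def)

lemma Low_in_region [simp]: "Low k \<in> region a b \<longleftrightarrow> 1 \<le> k \<and> k \<le> b"
  by (auto simp: region_def)

lemma finite_region [simp]: "finite (region a b)"
  by (simp add: region_def)

lemma region_subset_nodes: "a \<le> N \<Longrightarrow> b \<le> N \<Longrightarrow> region a b \<subseteq> nodes N"
  by (auto simp: region_def nodes_def)

lemma region_mono: "a \<le> a' \<Longrightarrow> b \<le> b' \<Longrightarrow> region a b \<subseteq> region a' b'"
  by (auto simp: region_def)

lemma region_Suc_Up: "region (Suc a) b = insert (Up (Suc a)) (region a b)"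
  by (auto simp: region_def atLeastAtMostSuc_conv)

lemma region_Suc_Low: "region a (Suc b) = insert (Low (Suc b)) (region a b)"
  by (auto simp: region_def atLeastAtMostSuc_conv)

lemma region_0_0 [simp]: "region 0 0 = {}"
  by (simp add: region_def)

lemma cut_nonneg: "0 \<le> cut m S"
  by (simp add: cut_def)

lemma cut_empty [simp]: "cut m {} = 0"
  by (simp add: cut_def)

lemma cut_cong: "(\<And>v. v \<in> S \<Longrightarrow> m v = m' v) \<Longrightarrow> cut m S = cut m' S"
  unfolding cut_def by (metis (mono_tags, lifting) Collect_cong)

lemma cut_insert:
  assumes m: "matching N m" and S: "S \<subseteq> nodes N" and x: "x \<in> nodes N" "x \<notin> S"
  shows "cut m (insert x S) = cut m S + (if m x \<in> S then -1 else 1)"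
proof -
  have fin: "finite S" using S finite_subset finite_nodes by blast
  note mx = matchingD[OF m x(1)]
  have inv: "m v = x \<longleftrightarrow> v = m x" if "v \<in> S" for v
    using matchingD(3)[OF m, of v] mx that S by auto
  show ?thesis
  proof (cases "m x \<in> S")
    case True
    have "{v \<in> insert x S. m v \<notin> insert x S} = {v \<in> S. m v \<notin> S} - {m x}"
      using True inv mx x(2) by auto
    moreover have "m x \<in> {v \<in> S. m v \<notin> S}" using True mx x(2) by auto
    ultimately show ?thesis
      using True fin card_Suc_Diff1[of "{v \<in> S. m v \<notin> S}" "m x"] by (simp add: cut_def)
  next
    case False
    then have "m v \<noteq> x" if "v \<in> S" for v using inv[OF that] that by metis
    then have "{v \<in> insert x S. m v \<notin> insert x S} = insert x {v \<in> S. m v \<notin> S}"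
      using False mx(2) by auto
    then show ?thesis using False x(2) fin by (simp add: cut_def)
  qed
qed

lemma cut_Suc_Up:
  assumes "matching N m" "Suc a \<le> N" "b \<le> N"
  shows "cut m (region (Suc a) b) =
    cut m (region a b) + (if m (Up (Suc a)) \<in> region a b then -1 else 1)"
  unfolding region_Suc_Up
  using assms by (intro cut_insert) (auto simp: region_subset_nodes)

lemma cut_Suc_Low:
  assumes "matching N m" "a \<le> N" "Suc b \<le> N"
  shows "cut m (region a (Suc b)) =
    cut m (region a b) + (if m (Low (Suc b)) \<in> region a b then -1 else 1)"
  unfolding region_Suc_Low
  using assms by (intro cut_insert) (auto simp: region_subset_nodes)

text \<open>Each cut edge is counted from both ends. In this form a change of \<open>m\<close> at a
  few nodes affects only their summands.\<close>

lemma cut_double: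
  assumes m: "matching N m" and S: "S \<subseteq> nodes N"
  shows "2 * cut m S = (\<Sum>v\<in>nodes N. sep S v (m v))"
proof -
  let ?A = "{v \<in> nodes N. v \<in> S \<and> m v \<notin> S}" and ?B = "{v \<in> nodes N. v \<notin> S \<and> m v \<in> S}"
  have "bij_betw m ?A ?B"
    by (rule bij_betwI[where g = m]) (use matchingD[OF m] in auto)
  then have "card ?A = card ?B" by (rule bij_betw_same_card)
  moreover have "?A = {v \<in> S. m v \<notin> S}" using S by auto
  moreover have "(\<Sum>v\<in>nodes N. sep S v (m v)) = (\<Sum>v\<in>?A \<union> ?B. 1)"
    by (rule sum.mono_neutral_cong_right) (auto simp: sep_def)
  moreover have "card (?A \<union> ?B) = card ?A + card ?B"
    by (rule card_Un_disjoint) auto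
  ultimately show ?thesis by (simp add: cut_def)
qed

text \<open>Only the four end nodes of two edges contribute to the difference. It serves
  \<open>T_act\<close> (with the partner of the second node as \<open>y\<close>),
  \<open>U_act\<close>, and, with the two matchings exchanged, the opening of an edge in
  \<open>peel_U\<close>.\<close>

lemma cut_rewire:
  assumes m: "matching N m" and m': "matching N m'" and S: "S \<subseteq> nodes N"
    and xy: "x \<in> nodes N" "y \<in> nodes N" "x \<noteq> y" "m x \<noteq> y"
    and new: "m' x = y" "m' (m x) = m y"
    and old: "\<And>v. v \<in> nodes N \<Longrightarrow> v \<notin> {x, y, m x, m y} \<Longrightarrow> m' v = m v"
  shows "cut m S - cut m' S = sep S x (m x) + sep S y (m y) - sep S x y - sep S (m x) (m y)"
proof -
  let ?Q = "{x, y, m x, m y}"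
  note mx = matchingD[OF m xy(1)] and my = matchingD[OF m xy(2)]
  have dist: "x \<noteq> m x" "y \<noteq> m y" "x \<noteq> m y" "m x \<noteq> m y"
    using mx my xy by metis+
  have new': "m' y = x" "m' (m y) = m x"
    using matchingD(3)[OF m'] new xy(1) mx(1) by metis+
  have Q: "?Q \<subseteq> nodes N" using xy mx my by auto
  have "(\<Sum>v\<in>nodes N. f v) = (\<Sum>v\<in>nodes N - ?Q. f v) + (f x + f y + f (m x) + f (m y))"
    for f :: "node \<Rightarrow> int"
    using sum.subset_diff[OF Q, of f] dist xy by (simp add: add.assoc)
  then have "2 * cut m S - 2 * cut m' S =
      (sep S x (m x) + sep S y (m y) + sep S (m x) x + sep S (m y) y) -
      (sep S x y + sep S y x + sep S (m x) (m y) + sep S (m y) (m x))"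
    unfolding cut_double[OF m S] cut_double[OF m' S]
    using mx(3) my(3) new new' old by simp
  then show ?thesis by (auto simp: sep_def split: if_splits)
qed

lemma region_pair:
  "a \<noteq> Suc j \<Longrightarrow> Up (Suc j) \<in> region a b \<longleftrightarrow> Up (Suc (Suc j)) \<in> region a b"
  by auto

lemma T_act_cup:
  assumes m: "matching N m" and j: "Suc (Suc j) \<le> N"
    and cup: "m (Up (Suc j)) = Up (Suc (Suc j))" and v: "v \<in> nodes N"
  shows "T_act j m v = m v"
proof -
  define x y where xy: "x = Up (Suc j)" "y = Up (Suc (Suc j))"
  have "x \<in> nodes N" "y \<in> nodes N" "m x = y" using j cup by (auto simp: xy)
  then have "m y = x" using matchingD(3)[OF m] by metis
  show ?thesis
  proof (cases "v = x \<or> v = y")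
    case True
    then show ?thesis using \<open>m x = y\<close> \<open>m y = x\<close> unfolding T_act_def xy[symmetric] by auto
  next
    case False
    then have "m v \<noteq> x" "m v \<noteq> y" using \<open>m x = y\<close> \<open>m y = x\<close> matchingD(3)[OF m v] by auto
    then show ?thesis using False unfolding T_act_def xy[symmetric] by simp
  qed
qed

lemma cut_T_act:
  assumes m: "matching N m" and j: "Suc (Suc j) \<le> N" and S: "S \<subseteq> nodes N"
    and nocup: "m (Up (Suc j)) \<noteq> Up (Suc (Suc j))"
  shows "cut m S - cut (T_act j m) S =
    sep S (Up (Suc j)) (m (Up (Suc j))) + sep S (Up (Suc (Suc j))) (m (Up (Suc (Suc j))))
    - sep S (Up (Suc j)) (m (Up (Suc (Suc j)))) - sep S (Up (Suc (Suc j))) (m (Up (Suc j)))"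
proof -
  define x y where xy: "x = Up (Suc j)" "y = Up (Suc (Suc j))"
  have n: "x \<in> nodes N" "y \<in> nodes N" "x \<noteq> y" using j by (auto simp: xy)
  note mx = matchingD[OF m n(1)] and my = matchingD[OF m n(2)]
  have dist: "m x \<noteq> y" "m y \<noteq> x" "m x \<noteq> m y" using nocup mx my n by (auto simp: xy)
  have T: "T_act j m v = transpose x y (m (transpose x y v))" for v
    by (simp add: T_act_def xy)
  have "cut m S - cut (T_act j m) S =
      sep S x (m x) + sep S (m y) (m (m y)) - sep S x (m y) - sep S (m x) (m (m y))"
  proof (rule cut_rewire[OF m matching_T_act[OF m j] S])
    show "T_act j m x = m y" using dist my by (simp add: T)
    show "T_act j m (m x) = m (m y)" using dist mx my by (simp add: T)
    fix v assume "v \<in> nodes N" and v: "v \<notin> {x, m y, m x, m (m y)}"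
    then have "m v \<noteq> x" "m v \<noteq> y" using matchingD(3)[OF m, of v] by auto
    then show "T_act j m v = m v" using v my(3) by (simp add: T)
  qed (use n my dist in auto)
  then show ?thesis using my(3) by (simp add: sep_def xy)
qed

text \<open>Outside row \<open>Suc j\<close> the region does not distinguish the two swapped
  nodes.\<close>

lemma cut_T_act_eq:
  assumes m: "matching N m" and j: "Suc (Suc j) \<le> N" and ab: "a \<le> N" "b \<le> N" "a \<noteq> Suc j"
  shows "cut (T_act j m) (region a b) = cut m (region a b)"
proof (cases "m (Up (Suc j)) = Up (Suc (Suc j))")
  case True
  then show ?thesis
    using T_act_cup[OF m j True] region_subset_nodes[OF ab(1,2)] by (intro cut_cong) auto
next
  case False
  show ?thesis
    using cut_T_act[OF m j region_subset_nodes[OF ab(1,2)] False] region_pair[OF ab(3), of b]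
    by (simp add: sep_def split: if_splits)
qed

text \<open>With both nodes on the same side of the region this is the triangle inequality for
  \<open>sep\<close>, along the path from \<open>m x\<close> over \<open>x\<close> and
  \<open>y\<close> to \<open>m y\<close>.\<close>

lemma cut_U_act_le:
  assumes m: "matching N m" and j: "Suc (Suc j) \<le> N" and ab: "a \<le> N" "b \<le> N" "a \<noteq> Suc j"
  shows "cut (U_act j m) (region a b) \<le> cut m (region a b)"
proof -
  define x y where xy: "x = Up (Suc j)" "y = Up (Suc (Suc j))"
  have n: "x \<in> nodes N" "y \<in> nodes N" "x \<noteq> y" using j by (auto simp: xy)
  note mx = matchingD[OF m n(1)] and my = matchingD[OF m n(2)]
  have U: "U_act j m v = (if v = x then y else if v = y then x
      else if m v = x then m y else if m v = y then m x else m v)" for v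
    by (simp add: U_act_def Let_def xy)
  have S: "region a b \<subseteq> nodes N" using ab by (simp add: region_subset_nodes)
  show ?thesis
  proof (cases "m x = y")
    case True
    then have "m y = x" using mx by simp
    then have "U_act j m v = m v" if "v \<in> nodes N" for v
      using True matchingD(3)[OF m that] by (auto simp: U)
    then have "cut (U_act j m) (region a b) = cut m (region a b)"
      using S by (intro cut_cong) auto
    then show ?thesis by simp
  next
    case False
    then have "m y \<noteq> x" using my by auto
    have "cut m (region a b) - cut (U_act j m) (region a b) =
      sep (region a b) x (m x) + sep (region a b) y (m y) - sep (region a b) x y - sep (region a b) (m x) (m y)"
    proof (rule cut_rewire[OF m matching_U_act[OF m j] S n False])
      show "U_act j m x = y" by (simp add: U)
      show "U_act j m (m x) = m y" using mx n(3) False by (simp add: U)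
      fix v assume "v \<in> nodes N" and v: "v \<notin> {x, y, m x, m y}"
      then have "m v \<noteq> x" "m v \<noteq> y" using matchingD(3)[OF m, of v] by auto
      then show "U_act j m v = m v" using v by (simp add: U)
    qed
    then show ?thesis
      using region_pair[OF ab(3), of b] by (auto simp: sep_def xy split: if_splits)
  qed
qed

section \<open>Permutation tangles\<close>

definition perm_mate :: "(nat \<Rightarrow> nat) \<Rightarrow> node \<Rightarrow> node" where
  "perm_mate p v = (case v of Up k \<Rightarrow> Low (p k) | Low k \<Rightarrow> Up (inv p k))"

lemma perm_mate_simps [simp]:
  "perm_mate p (Up k) = Low (p k)" "perm_mate p (Low k) = Up (inv p k)"
  by (simp_all add: perm_mate_def)

lemma matching_perm_mate:
  assumes "p permutes {1..N}"
  shows "matching N (perm_mate p)"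
  unfolding matching_def
proof (intro ballI)
  fix v assume v: "v \<in> nodes N"
  note pin = permutes_in_image[OF assms] permutes_in_image[OF permutes_inv[OF assms]]
  show "perm_mate p v \<in> nodes N \<and> perm_mate p v \<noteq> v \<and> perm_mate p (perm_mate p v) = v"
  proof (cases v)
    case (Up k)
    then show ?thesis using v pin(1)[of k] by (simp add: permutes_inverses[OF assms])
  next
    case (Low k)
    then show ?thesis using v pin(2)[of k] by (simp add: permutes_inverses[OF assms])
  qed
qed

lemma perm_mate_id: "perm_mate id = flip"
proof
  fix v show "perm_mate id v = flip v" by (cases v) simp_all
qed

lemma T_act_perm_mate:
  assumes "p permutes {1..N}"
  shows "T_act j (perm_mate p) = perm_mate (p \<circ> adj_transp j)"
proof
  fix v
  have inv: "inv (p \<circ> adj_transp j) = adj_transp j \<circ> inv p"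
    using permutes_bij[OF assms] by (simp add: o_inv_distrib)
  have up: "up_transp j (Up k) = Up (adj_transp j k)" for k
    by (simp add: transpose_def)
  have low: "up_transp j (Low k) = Low k" for k
    by (simp add: transpose_def)
  show "T_act j (perm_mate p) v = perm_mate (p \<circ> adj_transp j) v"
    unfolding T_act_def by (cases v) (simp_all only: up low perm_mate_simps inv o_apply)
qed

lemma cut_perm_mate:
  assumes p: "p permutes {1..N}" and ab: "a \<le> N" "b \<le> N"
  shows "cut (perm_mate p) (region a b) = csum p a b"
  using ab(1)
proof (induction a)
  case 0
  have "{v \<in> region 0 b. perm_mate p v \<notin> region 0 b} = Low ` {1..b}"
    by (auto simp: region_def)
  then show ?case by (simp add: cut_def card_image inj_on_def)
next
  case (Suc a)
  have "1 \<le> p (Suc a)" using Suc.prems permutes_in_image[OF p, of "Suc a"] by simp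
  then show ?case
    using Suc ab(2) by (simp add: cut_Suc_Up[OF matching_perm_mate[OF p]] csum_Suc)
qed

text \<open>The permutation \<open>q\<close> is the Demazure (0-Hecke) product of \<open>tau_word F\<close>.\<close>

lemma word_lower_bound:
  assumes "F \<in> words N"
  shows "\<exists>m q. matching N m \<and> compose_word N F = tangle_of N m \<and> q permutes {1..N} \<and>
    (\<forall>a\<le>N. \<forall>b\<le>N. cut m (region a b) \<le> csum q a b) \<and> inv_count N q \<le> length F \<and>
    (inv_count N q = length F \<longrightarrow> compose_word N (tau_word F) = tangle_of N (perm_mate q))"
  using assms
proof (induction F)
  case Nil
  have "cut flip (region a b) \<le> csum id a b" if "a \<le> N" "b \<le> N" for a b
    using cut_perm_mate[OF permutes_id that] by (simp add: perm_mate_id)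
  then show ?case
    using matching_flip permutes_id
    by (intro exI[of _ flip] exI[of _ id] conjI allI impI)
      (simp_all only: id_tangle_eq tau_word_def perm_mate_id compose_word.simps list.map
        inv_count_id le0)
next
  case (Cons P F)
  then have F: "F \<in> words N" by (simp add: words_def)
  obtain m q where m: "matching N m" and Fm: "compose_word N F = tangle_of N m"
    and q: "q permutes {1..N}"
    and le: "\<And>a b. a \<le> N \<Longrightarrow> b \<le> N \<Longrightarrow> cut m (region a b) \<le> csum q a b"
    and len: "inv_count N q \<le> length F"
    and tau: "inv_count N q = length F \<Longrightarrow> compose_word N (tau_word F) = tangle_of N (perm_mate q)"
    using Cons.IH[OF F] by blast
  have "1 \<le> prime_index P" "prime_index P + 1 \<le> N" using Cons.prems by (simp_all add: words_def)
  then obtain j where j: "prime_index P = Suc j" "Suc (Suc j) \<le> N"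
    by (metis One_nat_def Suc_eq_plus1 Suc_le_D)
  have tauP: "tau_prime P = TP (Suc j)" using j(1) by (cases P) simp_all
  define m' where "m' = (if is_TP P then T_act j m else U_act j m)"
  have m': "matching N m'"
    using matching_T_act[OF m j(2)] matching_U_act[OF m j(2)] by (simp add: m'_def)
  have PF: "compose_word N (P # F) = tangle_of N m'"
    using j(1) tangle_comp_T[OF m j(2)] tangle_comp_U[OF m j(2)]
    by (cases P) (simp_all add: Fm m'_def)
  have le': "cut m' (region a b) \<le> cut m (region a b)" if "a \<le> N" "b \<le> N" "a \<noteq> Suc j" for a b
    using cut_T_act_eq[OF m j(2) that] cut_U_act_le[OF m j(2) that] by (simp add: m'_def)
  \<comment> \<open>Adjacent rows of any cut differ by at most 1, and the resulting bound is
    precisely the value of \<open>csum\<close> at a descent.\<close>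
  have le_min: "cut m' (region (Suc j) b) \<le> min (csum q j b) (csum q (Suc (Suc j)) b) + 1"
    if b: "b \<le> N" for b
  proof -
    have "cut m' (region (Suc j) b) \<le> cut m' (region j b) + 1"
      "cut m' (region (Suc j) b) \<le> cut m' (region (Suc (Suc j)) b) + 1"
      using cut_Suc_Up[OF m' _ b, of j] cut_Suc_Up[OF m' _ b, of "Suc j"] j(2) by auto
    moreover have "cut m' (region j b) \<le> csum q j b"
      using le'[of j b] le[of j b] b j(2) by simp
    moreover have "cut m' (region (Suc (Suc j)) b) \<le> csum q (Suc (Suc j)) b"
      using le'[of "Suc (Suc j)" b] le[of "Suc (Suc j)" b] b j(2) by simp
    ultimately show ?thesis by simp
  qed
  have le'': "cut m' (region a b) \<le> csum q a b" if "a \<le> N" "b \<le> N" "a \<noteq> Suc j" for a b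
    using le[of a b] le'[of a b] that by simp
  show ?case
  proof (cases "q (Suc j) < q (Suc (Suc j))")
    case True
    define q' where "q' = q \<circ> adj_transp j"
    have "q' permutes {1..N}"
      unfolding q'_def using q adj_transp_permutes[OF j(2)] by (rule permutes_compose[rotated])
    moreover have "cut m' (region a b) \<le> csum q' a b" if "a \<le> N" "b \<le> N" for a b
      unfolding q'_def
      using le''[of a b] le_min[of b] that csum_transp_ascent[of q j b, OF True]
      by (cases "a = Suc j") (simp_all add: csum_transp)
    moreover have "inv_count N q' = Suc (inv_count N q)"
      unfolding q'_def using inv_count_transp[OF True j(2)] .
    \<comment> \<open>At an ascent the Demazure step is ordinary multiplication, so the two products
      still agree if they agreed for \<open>F\<close>.\<close>
    moreover have "compose_word N (tau_word (P # F)) = tangle_of N (perm_mate q')"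
      if "inv_count N q = length F"
      using tau[OF that] tangle_comp_T[OF matching_perm_mate[OF q] j(2)]
      by (simp add: tau_word_def tauP T_act_perm_mate[OF q] q'_def del: prime_tangle.simps)
    ultimately show ?thesis using m' PF len by (intro exI[of _ m'] exI[of _ q']) auto
  next
    case False
    then have desc: "q (Suc (Suc j)) < q (Suc j)"
      using permutes_Suc_neq[OF q, of j] by simp
    have "cut m' (region a b) \<le> csum q a b" if "a \<le> N" "b \<le> N" for a b
      using le''[of a b] le_min[of b] that csum_descent[of q j b, OF desc]
      by (cases "a = Suc j") simp_all
    \<comment> \<open>The letter is absorbed: \<open>q\<close> stays while the word grows, so
      equality of \<open>inv_count N q\<close> with the length cannot occur.\<close>
    then show ?thesis using m' PF len q by (intro exI[of _ m'] exI[of _ q]) auto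
  qed
qed

section \<open>Splitting off a prime\<close>

definition mcut :: "(node \<Rightarrow> node) \<Rightarrow> nat \<Rightarrow> nat \<Rightarrow> int" where
  "mcut m a b = max \<bar>int a - int b\<bar> (cut m (region a b))"

text \<open>Every node added to the region changes the cut by 1. Later this widens strict
  inequalities between cuts and \<open>|a - b|\<close> to gaps of 2.\<close>

lemma cut_parity:
  assumes m: "matching N m" and ab: "a \<le> N" "b \<le> N"
  shows "even (cut m (region a b) + int a + int b)"
proof -
  have base: "b \<le> N \<Longrightarrow> even (cut m (region 0 b) + int b)" for b
    by (induction b) (simp_all add: cut_Suc_Low[OF m])
  show ?thesis
    using ab(1) by (induction a) (use base[OF ab(2)] ab(2) in \<open>simp_all add: cut_Suc_Up[OF m]\<close>)
qed

lemma cut_lipschitz: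
  assumes m: "matching N m" and b: "b \<le> N" and aa': "a \<le> a'" "a' \<le> N"
  shows "\<bar>cut m (region a' b) - cut m (region a b)\<bar> \<le> int a' - int a"
  using aa'
proof (induction a' rule: dec_induct)
  case (step n)
  then show ?case using cut_Suc_Up[OF m _ b, of n] by (simp split: if_splits)
qed simp

fun col :: "node \<Rightarrow> nat" where
  "col (Up k) = k"
| "col (Low k) = k"

text \<open>The comparison is strict at the left node and weak at the right one, so that a cup on
  the two nodes qualifies, as may a vertical edge at the right node. For a permutation this is a
  special kind of descent.\<close>

definition descent :: "(node \<Rightarrow> node) \<Rightarrow> nat \<Rightarrow> bool" where
  "descent m j \<longleftrightarrow> Suc j < col (m (Up (Suc j))) \<and> col (m (Up (Suc (Suc j)))) \<le> Suc (Suc j)"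

lemma col_nodes: "v \<in> nodes N \<Longrightarrow> col v \<le> N"
  by (cases v) auto

text \<open>The last upper node can only lead weakly left, and absence of descents passes this on to
  all upper nodes. From left to right the smaller columns are then used up, which leaves only
  vertical edges.\<close>

lemma no_descent_flip:
  assumes m: "matching N m" and no: "\<And>j. Suc (Suc j) \<le> N \<Longrightarrow> \<not> descent m j" and v: "v \<in> nodes N"
  shows "m v = flip v"
proof -
  have left: "col (m (Up k)) \<le> k" if "1 \<le> k" "k \<le> N" for k
    using that(2,1)
  proof (induction k rule: inc_induct)
    case base
    then show ?case using matchingD(1)[OF m, of "Up N"] col_nodes by simp
  next
    case (step k)
    then obtain j where "k = Suc j" by (metis One_nat_def Suc_le_D)
    then show ?case using no[of j] step by (auto simp: descent_def)
  qed
  have up: "m (Up k) = Low k" if "1 \<le> k" "k \<le> N" for k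
    using that
  proof (induction k rule: less_induct)
    case (less k)
    then have k: "Up k \<in> nodes N" by simp
    note mk = matchingD[OF m k]
    show ?case
    proof (cases "m (Up k)")
      case (Up l)
      then have "l < k" "1 \<le> l" using left[OF less.prems] mk by auto
      then have "m (Up l) = Low l" using less by simp
      then show ?thesis using Up mk(3) by simp
    next
      case (Low l)
      show ?thesis
      proof (cases "l = k")
        case False
        then have l: "l < k" "1 \<le> l" "l \<le> N" using Low left[OF less.prems] mk(1) by auto
        then have "m (Up l) = Low l" using less by simp
        then have "m (Low l) = Up l" using matchingD(3)[OF m, of "Up l"] l by simp
        then show ?thesis using Low mk(3) False by simp
      qed (use Low in simp)
    qed
  qed
  show ?thesis
  proof (cases v)
    case (Up k)
    then show ?thesis using up v by simp
  next
    case (Low k)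
    then show ?thesis using up[of k] v matchingD(3)[OF m, of "Up k"] by simp
  qed
qed

text \<open>The analogue of \<open>csum_descent\<close>. A valley of the cut in row
  \<open>Suc j\<close> is impossible: the step down needs \<open>b\<close> at least
  \<open>j + 2\<close>, because the left edge must end at a lower node beyond column
  \<open>Suc j\<close>, and the step up needs \<open>b\<close> at most \<open>j + 1\<close>.\<close>

lemma mcut_descent:
  assumes m: "matching N m" and j: "Suc (Suc j) \<le> N" and b: "b \<le> N" and desc: "descent m j"
  shows "mcut m (Suc j) b = min (mcut m j b) (mcut m (Suc (Suc j)) b) + 1"
proof -
  let ?x = "Up (Suc j)" and ?y = "Up (Suc (Suc j))"
  have e1: "Suc (Suc j) \<le> b" if "m ?x \<in> region j b"
    using that desc by (cases "m ?x") (auto simp: descent_def)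
  have e2: "b \<le> Suc j" if "m ?y \<notin> region (Suc j) b"
    using that desc matchingD[OF m, of ?y] j by (cases "m ?y") (auto simp: descent_def)
  define c0 c1 c2 where "c0 = cut m (region j b)" "c1 = cut m (region (Suc j) b)"
    "c2 = cut m (region (Suc (Suc j)) b)"
  have c: "c1 = c0 + (if m ?x \<in> region j b then -1 else 1)"
    "c2 = c1 + (if m ?y \<in> region (Suc j) b then -1 else 1)"
    using cut_Suc_Up[OF m _ b, of j] cut_Suc_Up[OF m _ b, of "Suc j"] j
    by (simp_all add: c0_c1_c2_def)
  have nonneg: "0 \<le> c0" "0 \<le> c1" "0 \<le> c2"
    by (simp_all only: c0_c1_c2_def cut_nonneg)
  have "even (c0 + int j + int b)" using cut_parity[OF m _ b, of j] j by (simp add: c0_c1_c2_def)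
  \<comment> \<open>For \<open>b = j + 1\<close> the distances in the three rows are 1, 0, 1. This
    dip is hidden because the cut in row \<open>j\<close> is odd there, hence positive.\<close>
  then have diag: "1 \<le> c0" if "int b = int j + 1" using that nonneg(1) by (cases "c0 = 0") auto
  have M: "mcut m j b = max \<bar>int j - int b\<bar> c0" "mcut m (Suc j) b = max \<bar>int j + 1 - int b\<bar> c1"
    "mcut m (Suc (Suc j)) b = max \<bar>int j + 2 - int b\<bar> c2"
    by (simp_all add: mcut_def c0_c1_c2_def)
  consider "c1 = c0 - 1" "c2 = c0 - 2" "int b \<ge> int j + 2"
    | "c1 = c0 + 1" "c2 = c0 + 2" "int b \<le> int j + 1" | "c1 = c0 + 1" "c2 = c0"
    using c e1 e2 by (auto split: if_splits)
  then show ?thesis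
  proof cases
    case 1
    then show ?thesis unfolding M by (simp add: max_def min_def)
  next
    case 2
    show ?thesis
    proof (cases "int b = int j + 1")
      case True
      then show ?thesis unfolding M using 2 diag by (simp add: max_def min_def)
    next
      case False
      then show ?thesis unfolding M using 2 by (simp add: max_def min_def)
    qed
  next
    case 3
    consider "int b \<le> int j" | "int b = int j + 1" | "int j + 2 \<le> int b" by linarith
    then show ?thesis unfolding M using 3 diag by cases (simp_all add: max_def min_def)
  qed
qed

text \<open>One strict drop in row \<open>Suc j\<close> suffices: it makes the recursion terminate,
  and it forces the permutation of \<open>m'\<close> to have an ascent there.\<close>

definition peels :: "nat \<Rightarrow> nat \<Rightarrow> (node \<Rightarrow> node) \<Rightarrow> (node \<Rightarrow> node) \<Rightarrow> bool" where
  "peels N j m m' \<longleftrightarrow> matching N m' \<and>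
    (\<forall>a\<le>N. \<forall>b\<le>N. a \<noteq> Suc j \<longrightarrow> mcut m' a b = mcut m a b) \<and>
    (\<exists>b\<le>N. mcut m' (Suc j) b < mcut m (Suc j) b)"

lemma peel_T:
  assumes m: "matching N m" and j: "Suc (Suc j) \<le> N" and desc: "descent m j"
    and nocup: "m (Up (Suc j)) \<noteq> Up (Suc (Suc j))"
  shows "peels N j m (T_act j m)"
  unfolding peels_def
proof (intro conjI allI impI)
  show "matching N (T_act j m)" by (rule matching_T_act[OF m j])
  show "mcut (T_act j m) a b = mcut m a b" if "a \<le> N" "b \<le> N" "a \<noteq> Suc j" for a b
    using cut_T_act_eq[OF m j that] by (simp add: mcut_def)
  define x y where xy: "x = Up (Suc j)" "y = Up (Suc (Suc j))"
  have n: "x \<in> nodes N" "y \<in> nodes N" "x \<noteq> y" using j by (auto simp: xy)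
  note mx = matchingD[OF m n(1)] and my = matchingD[OF m n(2)]
  have dist: "m x \<noteq> m y" using mx my n by metis
  \<comment> \<open>The region is one column wider if the right node has a vertical edge, so that
    \<open>m y\<close> is inside and \<open>m x\<close> outside in every case. Both edges are then
    cut, and neither is after the swap.\<close>
  define b where "b = (if m y = Low (Suc (Suc j)) then Suc (Suc j) else Suc j)"
  have b: "b \<le> N" using j by (simp add: b_def)
  let ?S = "region (Suc j) b"
  have "m x \<notin> ?S"
    using desc dist by (cases "m x") (auto simp: descent_def xy b_def)
  moreover have "m y \<in> ?S"
    using desc my(1,2) by (cases "m y") (auto simp: descent_def xy b_def le_Suc_eq)
  moreover have "?S \<subseteq> nodes N" using j b by (intro region_subset_nodes) auto
  ultimately have "cut m ?S - cut (T_act j m) ?S = 2"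
    using cut_T_act[OF m j, of ?S] nocup unfolding xy[symmetric] by (simp add: sep_def xy)
  moreover have "0 \<le> cut (T_act j m) ?S" by (rule cut_nonneg)
  moreover have "even (cut m ?S + int (Suc j) + int b)" using j b by (intro cut_parity[OF m]) auto
  moreover have "b = Suc j \<or> b = Suc (Suc j)" by (simp add: b_def)
  ultimately have "mcut (T_act j m) (Suc j) b < mcut m (Suc j) b"
    by (auto simp: mcut_def elim!: evenE)
  then show "\<exists>b\<le>N. mcut (T_act j m) (Suc j) b < mcut m (Suc j) b" using b by blast
qed

text \<open>Otherwise the \<open>b1 - b2\<close> lower nodes between the two regions would have to absorb both cuts.\<close>

lemma escaping_edge:
  assumes m: "matching N m" and A: "b2 \<le> b1" "b1 \<le> N" "a \<le> N"
    and big: "int b1 - int b2 < cut m (region a b2) + cut m (region a b1)"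
  obtains p where "p \<in> region a b2" "m p \<notin> region a b1"
proof (rule ccontr)
  note found = that
  assume "\<not> thesis"
  then have inside: "m p \<in> region a b1" if "p \<in> region a b2" for p
    using found that by blast
  let ?A = "region a b2" and ?B = "region a b1" and ?D = "Low ` {b2<..b1}"
  have sub: "?A \<subseteq> nodes N" "?B \<subseteq> nodes N" using A by (simp_all add: region_subset_nodes)
  have "{1..b1} = {1..b2} \<union> {b2<..b1}" using A(1) by auto
  then have diff: "?B = ?A \<union> ?D" "?A \<inter> ?D = {}" by (auto simp: region_def image_Un)
  have inj: "inj_on m ?A" using sub matchingD(3)[OF m] by (metis (no_types) inj_onI subsetD)
  let ?P = "{v \<in> ?D. m v \<in> ?A}" and ?Q = "{v \<in> ?D. m v \<notin> ?B}"
  have "m ` {v \<in> ?A. m v \<notin> ?A} \<subseteq> ?P"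
  proof (rule image_subsetI)
    fix v assume v: "v \<in> {v \<in> ?A. m v \<notin> ?A}"
    then have "m v \<in> ?D" using inside[of v] diff(1) by blast
    moreover have "m (m v) = v" using v sub(1) matchingD(3)[OF m] by blast
    ultimately show "m v \<in> ?P" using v by simp
  qed
  then have "card (m ` {v \<in> ?A. m v \<notin> ?A}) \<le> card ?P" by (intro card_mono) auto
  moreover have "card (m ` {v \<in> ?A. m v \<notin> ?A}) = card {v \<in> ?A. m v \<notin> ?A}"
    using inj by (intro card_image) (auto simp: inj_on_def)
  moreover have "{v \<in> ?B. m v \<notin> ?B} \<subseteq> ?Q" using inside diff by blast
  then have "card {v \<in> ?B. m v \<notin> ?B} \<le> card ?Q" by (intro card_mono) auto
  moreover have "card ?P + card ?Q = card (?P \<union> ?Q)"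
    using diff by (intro card_Un_disjoint[symmetric]) auto
  moreover have "card (?P \<union> ?Q) \<le> card ?D" by (intro card_mono) auto
  moreover have "card ?D = b1 - b2" by (simp add: card_image inj_on_def)
  ultimately show False using big A(1) by (simp add: cut_def)
qed

text \<open>\<open>m'\<close> splits an edge \<open>{p, q}\<close> of \<open>m\<close>. This keeps \<open>mcut\<close> outside row \<open>Suc j\<close> if the edge leaves every
  region above and meets every region below that row whose cut is not dominated by \<open>\<bar>a - b\<bar>\<close>;
  \<open>region j b1\<close> contains all of the former and \<open>region (Suc (Suc j)) b2\<close> lies in all of the latter.\<close>

lemma peel_U:
  assumes m: "matching N m" and j: "Suc (Suc j) \<le> N"
    and cup: "m (Up (Suc j)) = Up (Suc (Suc j))"
  shows "\<exists>m'. peels N j m m' \<and> (\<forall>v\<in>nodes N. U_act j m' v = m v)"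
proof -
  define x y where xy: "x = Up (Suc j)" "y = Up (Suc (Suc j))"
  have n: "x \<in> nodes N" "y \<in> nodes N" "x \<noteq> y" using j by (auto simp: xy)
  have mxy: "m x = y" "m y = x" using cup matchingD(3)[OF m n(1)] by (simp_all add: xy)
  define C where "C a b = cut m (region a b)" for a b
  have parity: "even (C a b + int a + int b)" if "a \<le> N" "b \<le> N" for a b
    using cut_parity[OF m that] by (simp add: C_def)
  have lip: "\<bar>C a' b - C a b\<bar> \<le> int a' - int a" if "b \<le> N" "a \<le> a'" "a' \<le> N" for a a' b
    using cut_lipschitz[OF m that] by (simp add: C_def)
  have C_eq: "C (Suc (Suc j)) b = C j b" if "b \<le> N" for b
    using cut_Suc_Up[OF m _ that, of j] cut_Suc_Up[OF m _ that, of "Suc j"] j mxy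
    by (simp add: C_def xy)
  have "even (C j (Suc j) + int j + int (Suc j))" using j by (intro parity) auto
  moreover have "0 \<le> C j (Suc j)" by (simp add: C_def cut_nonneg)
  ultimately have Cj: "1 \<le> C j (Suc j)" by (cases "C j (Suc j) = 0") auto
  \<comment> \<open>Columns where \<open>|a - b|\<close> does not exceed the cut by 2, seen from
    above the cup (row \<open>j\<close>) and from below it (row \<open>j + 2\<close>, whose cuts
    equal those of row \<open>j\<close>). By parity of the cut at \<open>(j, j + 1)\<close>, column
    \<open>Suc j\<close> belongs to both sets.\<close>
  define B1 where "B1 = {b. b \<le> N \<and> int b - int j \<le> C j b}"
  define B2 where "B2 = {b. b \<le> N \<and> int j + 2 - int b \<le> C j b}"
  have fin: "finite B1" "finite B2" by (auto simp: B1_def B2_def)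
  have mem: "Suc j \<in> B1" "Suc j \<in> B2" using j Cj by (auto simp: B1_def B2_def)
  define b1 b2 where "b1 = Max B1" "b2 = Min B2"
  note b12 = b1_b2_def
  have "b1 \<in> B1" "b2 \<in> B2" using Max_in[OF fin(1)] Min_in[OF fin(2)] mem by (auto simp: b12)
  then have b1: "b1 \<le> N" "int b1 - int j \<le> C j b1" and b2: "b2 \<le> N" "int j + 2 - int b2 \<le> C j b2"
    by (auto simp: B1_def B2_def)
  have b1_ge: "Suc j \<le> b1" and b2_le: "b2 \<le> Suc j"
    using Max_ge[OF fin(1) mem(1)] Min_le[OF fin(2) mem(2)] by (simp_all add: b12)
  \<comment> \<open>Failing the condition of \<open>B1\<close> means a gap of 2 by parity; the
    Lipschitz bound carries this gap to all rows above.\<close>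
  have right: "C a b + 2 \<le> int b - int a" if "a \<le> j" "b1 < b" "b \<le> N" for a b
  proof -
    have "b \<notin> B1" using that(2) Max_ge[OF fin(1), of b] by (auto simp: b12)
    then have "C j b < int b - int j" using that by (simp add: B1_def)
    moreover have "even (C j b + int j + int b)" using j that by (intro parity) auto
    ultimately have "C j b + 2 \<le> int b - int j" by presburger
    then show ?thesis using lip[of b a j] that j by simp
  qed
  have left: "C a b + 2 \<le> int a - int b" if "Suc (Suc j) \<le> a" "a \<le> N" "b < b2" for a b
  proof -
    have bN: "b \<le> N" using that b2 by simp
    have "b \<notin> B2" using that(3) Min_le[OF fin(2), of b] by (auto simp: b12)
    then have "C j b < int j + 2 - int b" using bN by (simp add: B2_def)
    moreover have "even (C j b + int j + int b)" using j bN by (intro parity) auto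
    ultimately have "C j b + 2 \<le> int j + 2 - int b" by presburger
    then show ?thesis using lip[of b "Suc (Suc j)" a] that bN C_eq[OF bN] by simp
  qed
  \<comment> \<open>Adding the defining inequalities of \<open>b1\<close> and \<open>b2\<close>
    gives \<open>b1 - b2 + 2\<close> as a lower bound for the sum of the two cuts.\<close>
  obtain p where p: "p \<in> region j b2" "m p \<notin> region j b1"
    using escaping_edge[OF m, of b2 b1 j] b1 b2 b1_ge b2_le j by (auto simp: C_def)
  define q where "q = m p"
  have pn: "p \<in> nodes N" using p(1) region_subset_nodes[of j N b2] j b2(1) by auto
  note mp = matchingD[OF m pn]
  have qn: "q \<in> nodes N" "m q = p" "m p = q" "p \<noteq> q" using mp by (auto simp: q_def)
  have px: "p \<noteq> x" "p \<noteq> y" using p(1) by (auto simp: xy)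
  then have qx: "q \<noteq> x" "q \<noteq> y" using mxy qn by auto
  \<comment> \<open>The cup and the edge \<open>{p, q}\<close> become \<open>{x, p}\<close> and
    \<open>{y, q}\<close>; applying \<open>U_act\<close> joins \<open>p\<close> to \<open>q\<close>
    and restores the cup.\<close>
  define m' where "m' v = (if v = x then p else if v = p then x else
      if v = y then q else if v = q then y else m v)" for v
  have m': "matching N m'"
    unfolding matching_def
  proof (intro ballI)
    fix v assume v: "v \<in> nodes N"
    note mv = matchingD[OF m v]
    show "m' v \<in> nodes N \<and> m' v \<noteq> v \<and> m' (m' v) = v"
    proof (cases "v \<in> {x, y, p, q}")
      case True
      then show ?thesis using n pn qn px qx by (auto simp: m'_def)
    next
      case False
      then have "m v \<notin> {x, y, p, q}" using mxy qn mv(3) by auto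
      then show ?thesis using False mv by (simp add: m'_def)
    qed
  qed
  have U: "U_act j m' v = m v" if v: "v \<in> nodes N" for v
  proof (cases "v \<in> {x, y, p, q}")
    case True
    then show ?thesis
      using n(3) mxy qn px qx unfolding U_act_def Let_def xy[symmetric] by (auto simp: m'_def)
  next
    case False
    then have "m v \<notin> {x, y, p, q}" using mxy qn matchingD(3)[OF m v] by auto
    then show ?thesis using False unfolding U_act_def Let_def xy[symmetric] by (simp add: m'_def)
  qed
  have m'x: "m' x = p" "m' y = q" using n(3) px qx by (auto simp: m'_def)
  have rewire: "cut m' S - cut m S = sep S x p + sep S y q - sep S x y - sep S p q"
    if S: "S \<subseteq> nodes N" for S
    using cut_rewire[OF m' m S n, unfolded m'x] mxy(1) qn(3) px qx by (simp add: m'_def)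
  have "mcut m' a b = mcut m a b" if ab: "a \<le> N" "b \<le> N" "a \<noteq> Suc j" for a b
  proof -
    let ?S = "region a b"
    have "x \<in> ?S \<longleftrightarrow> y \<in> ?S" using ab(3) by (auto simp: xy)
    \<comment> \<open>With \<open>x\<close> and \<open>y\<close> on the same side the cut can only
      grow, namely when \<open>{p, q}\<close> lies entirely on the other side.\<close>
    then have d: "cut m' ?S = cut m ?S + (if (p \<in> ?S \<longleftrightarrow> q \<in> ?S) \<and> (p \<in> ?S \<longleftrightarrow> x \<notin> ?S) then 2 else 0)"
      using rewire[OF region_subset_nodes[OF ab(1,2)]] by (auto simp: sep_def split: if_splits)
    show ?thesis
    proof (cases "(p \<in> ?S \<longleftrightarrow> q \<in> ?S) \<and> (p \<in> ?S \<longleftrightarrow> x \<notin> ?S)")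
      case opposite: True
      have "C a b + 2 \<le> \<bar>int a - int b\<bar>"
      proof (cases "x \<in> ?S")
        case True
        then have a: "Suc (Suc j) \<le> a" using ab(3) by (simp add: xy)
        have "p \<notin> region a b" using opposite True by blast
        then have "b < b2" using p(1) region_mono[of j a b2 b] a by (meson Suc_leD not_le subsetD)
        then show ?thesis using left[OF a ab(1)] by fastforce
      next
        case False
        then have a: "a \<le> j" by (simp add: xy)
        have "q \<in> region a b" using opposite False by blast
        then have "b1 < b" using p(2) region_mono[of a j b b1] a by (metis q_def not_le subsetD)
        then show ?thesis using right[OF a _ ab(2)] by fastforce
      qed
      then show ?thesis using d opposite by (simp add: mcut_def C_def)
    next
      case False
      then show ?thesis using d[unfolded if_not_P[OF False]] by (simp add: mcut_def)
    qed
  qed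
  \<comment> \<open>In this square region cup and edge are both cut in \<open>m\<close>, and neither
    of the new edges is cut in \<open>m'\<close>; the distance 0 masks nothing.\<close>
  moreover have "mcut m' (Suc j) (Suc j) < mcut m (Suc j) (Suc j)"
  proof -
    let ?S = "region (Suc j) (Suc j)"
    have S: "?S \<subseteq> nodes N" using j by (intro region_subset_nodes) auto
    have "x \<in> ?S" "y \<notin> ?S" by (auto simp: xy)
    moreover have "p \<in> ?S" using p(1) region_mono[of j "Suc j" b2 "Suc j"] b2_le by auto
    moreover have "q \<notin> ?S"
    proof (cases q)
      case (Up k)
      then show ?thesis using p(2) qx(1) by (auto simp: q_def[symmetric] xy)
    next
      case (Low k)
      then show ?thesis using p(2) b1_ge by (auto simp: q_def[symmetric])
    qed
    ultimately have "cut m' ?S - cut m ?S = -2" using rewire[OF S] by (simp add: sep_def)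
    then show ?thesis using cut_nonneg[of m' ?S] by (simp add: mcut_def)
  qed
  ultimately have "peels N j m m'" using m' j unfolding peels_def by (meson Suc_leD)
  then show ?thesis using U by blast
qed

text \<open>Row \<open>Suc j\<close> of \<open>m'\<close> exceeds its neighbours by at most 1, and
  \<open>mcut_descent\<close> says that \<open>m\<close> attains this bound.\<close>

lemma peels_mcut_le:
  assumes m: "matching N m" and j: "Suc (Suc j) \<le> N" and desc: "descent m j"
    and p: "peels N j m m'" and ab: "a \<le> N" "b \<le> N"
  shows "mcut m' a b \<le> mcut m a b"
proof (cases "a = Suc j")
  case True
  have m': "matching N m'" using p by (simp add: peels_def)
  have "mcut m' (Suc j) b \<le> mcut m' j b + 1" "mcut m' (Suc j) b \<le> mcut m' (Suc (Suc j)) b + 1"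
    using cut_lipschitz[OF m' ab(2), of j "Suc j"] cut_lipschitz[OF m' ab(2), of "Suc j" "Suc (Suc j)"] j
    by (auto simp: mcut_def)
  moreover have "mcut m' j b = mcut m j b" "mcut m' (Suc (Suc j)) b = mcut m (Suc (Suc j)) b"
    using p ab(2) j by (auto simp: peels_def)
  ultimately show ?thesis using mcut_descent[OF m j ab(2) desc] True by simp
qed (use p ab in \<open>simp add: peels_def\<close>)

text \<open>A descent of \<open>q\<close> would give row \<open>Suc j\<close> the value it has for
  \<open>m\<close>, against the strict drop. So \<open>q\<close> has an ascent, and inserting the
  transposition raises the row to that value.\<close>

lemma peels_csum:
  assumes m: "matching N m" and j: "Suc (Suc j) \<le> N" and desc: "descent m j"
    and p: "peels N j m m'" and q: "q permutes {1..N}"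
    and eq: "\<And>a b. a \<le> N \<Longrightarrow> b \<le> N \<Longrightarrow> csum q a b = mcut m' a b"
  shows "q (Suc j) < q (Suc (Suc j))"
    "\<And>a b. a \<le> N \<Longrightarrow> b \<le> N \<Longrightarrow> csum (q \<circ> adj_transp j) a b = mcut m a b"
proof -
  have eq': "csum q a b = mcut m a b" if "a \<le> N" "b \<le> N" "a \<noteq> Suc j" for a b
    using eq that p by (simp add: peels_def)
  have min: "mcut m (Suc j) b = min (csum q j b) (csum q (Suc (Suc j)) b) + 1" if "b \<le> N" for b
    using mcut_descent[OF m j that desc] eq'[of j b] eq'[of "Suc (Suc j)" b] that j by simp
  show asc: "q (Suc j) < q (Suc (Suc j))"
  proof (rule ccontr)
    assume "\<not> ?thesis"
    then have desc': "q (Suc (Suc j)) < q (Suc j)" using permutes_Suc_neq[OF q, of j] by simp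
    obtain b where b: "b \<le> N" "mcut m' (Suc j) b < mcut m (Suc j) b" using p by (auto simp: peels_def)
    then show False
      using csum_descent[of q j b, OF desc'] eq[OF Suc_leD[OF j] b(1)] min[OF b(1)] by linarith
  qed
  show "csum (q \<circ> adj_transp j) a b = mcut m a b" if "a \<le> N" "b \<le> N" for a b
    using that csum_transp_ascent[of q j b, OF asc] min eq'
    by (cases "a = Suc j") (simp_all add: csum_transp)
qed

text \<open>Induction on the total of \<open>mcut\<close>: each prime split off accounts for one
  letter and one inversion.\<close>

lemma factorization_attaining:
  assumes "matching N m"
  shows "\<exists>F q. F \<in> words N \<and> compose_word N F = tangle_of N m \<and> q permutes {1..N} \<and>
    (\<forall>a\<le>N. \<forall>b\<le>N. csum q a b = mcut m a b) \<and> length F = inv_count N q"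
  using assms
proof (induction "nat (\<Sum>z\<in>{..N}\<times>{..N}. mcut m (fst z) (snd z))" arbitrary: m rule: less_induct)
  case less
  note m = less.prems
  show ?case
  proof (cases "\<exists>j. Suc (Suc j) \<le> N \<and> descent m j")
    case False
    then have flip: "m v = flip v" if "v \<in> nodes N" for v
      using no_descent_flip[OF m _ that] by blast
    then have tangle: "tangle_of N m = tangle_of N flip" by (intro tangle_of_cong)
    \<comment> \<open>Cuts of the identity already dominate \<open>|a - b|\<close>, so the maximum
      changes nothing.\<close>
    have "csum id a b = mcut m a b" if ab: "a \<le> N" "b \<le> N" for a b
    proof -
      have "cut m (region a b) = cut (perm_mate id) (region a b)"
        using flip region_subset_nodes[OF ab] by (intro cut_cong) (auto simp: perm_mate_id)
      also have "\<dots> = csum id a b" by (rule cut_perm_mate[OF permutes_id ab])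
      finally show ?thesis using csum_ge_abs[OF permutes_id, of a b] by (simp add: mcut_def)
    qed
    then have "\<forall>a\<le>N. \<forall>b\<le>N. csum id a b = mcut m a b" by blast
    moreover have "[] \<in> words N" "compose_word N [] = tangle_of N m"
      "length ([] :: word) = inv_count N id"
      using tangle by (simp_all only: id_tangle_eq compose_word.simps inv_count_id list.size) (simp add: words_def)
    ultimately show ?thesis using permutes_id by blast
  next
    case True
    then obtain j where j: "Suc (Suc j) \<le> N" and desc: "descent m j" by blast
    obtain P m' where P: "prime_index P = Suc j" and peel: "peels N j m m'"
      and comp: "tangle_comp (prime_tangle N P) (tangle_of N m') = tangle_of N m"
    proof (cases "m (Up (Suc j)) = Up (Suc (Suc j))")
      case True
      then obtain m' where m': "peels N j m m'" "\<forall>v\<in>nodes N. U_act j m' v = m v"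
        using peel_U[OF m j] by blast
      then have "tangle_of N (U_act j m') = tangle_of N m" by (intro tangle_of_cong) auto
      then show ?thesis
        using that[of "UP (Suc j)" m'] m'(1) tangle_comp_U[of N m' j] j
        by (simp add: peels_def del: prime_tangle.simps)
    next
      case False
      have "T_act j (T_act j m) = m" by (rule ext) (simp add: T_act_def)
      then show ?thesis
        using that[of "TP (Suc j)" "T_act j m"] peel_T[OF m j desc False]
          tangle_comp_T[OF matching_T_act[OF m j] j]
        by (simp del: prime_tangle.simps)
    qed
    have m': "matching N m'" using peel by (simp add: peels_def)
    obtain b where b: "b \<le> N" "mcut m' (Suc j) b < mcut m (Suc j) b"
      using peel by (auto simp: peels_def)
    have "(\<Sum>z\<in>{..N}\<times>{..N}. mcut m' (fst z) (snd z)) < (\<Sum>z\<in>{..N}\<times>{..N}. mcut m (fst z) (snd z))"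
    proof (rule sum_strict_mono_ex1)
      show "\<forall>z\<in>{..N}\<times>{..N}. mcut m' (fst z) (snd z) \<le> mcut m (fst z) (snd z)"
        using peels_mcut_le[OF m j desc peel] by auto
      show "\<exists>z\<in>{..N}\<times>{..N}. mcut m' (fst z) (snd z) < mcut m (fst z) (snd z)"
        using b j by (intro bexI[of _ "(Suc j, b)"]) auto
    qed simp
    moreover have "0 \<le> (\<Sum>z\<in>{..N}\<times>{..N}. mcut m' (fst z) (snd z))"
      by (intro sum_nonneg) (simp add: mcut_def)
    ultimately obtain F q where F: "F \<in> words N" "compose_word N F = tangle_of N m'"
      and q: "q permutes {1..N}" and eq: "\<And>a b. a \<le> N \<Longrightarrow> b \<le> N \<Longrightarrow> csum q a b = mcut m' a b"
      and len: "length F = inv_count N q"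
      using less.hyps[OF _ m'] by auto
    define q' where "q' = q \<circ> adj_transp j"
    note csum = peels_csum[OF m j desc peel q eq]
    have "q' permutes {1..N}"
      unfolding q'_def using q adj_transp_permutes[OF j] by (rule permutes_compose[rotated])
    moreover have "\<forall>a\<le>N. \<forall>b\<le>N. csum q' a b = mcut m a b" using csum(2) by (simp add: q'_def)
    moreover have "length (P # F) = inv_count N q'"
      using inv_count_transp[OF csum(1) j] len by (simp add: q'_def)
    moreover have "P # F \<in> words N" using F(1) P j by (simp add: words_def)
    moreover have "compose_word N (P # F) = tangle_of N m" using F(2) comp by simp
    ultimately show ?thesis by blast
  qed
qed

section \<open>Lengths\<close>

lemma cut_mate_tangle_of:
  assumes "matching N m" "a \<le> N" "b \<le> N"
  shows "cut (mate (tangle_of N m)) (region a b) = cut m (region a b)"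
  using region_subset_nodes[OF assms(2,3)] mate_tangle_of[OF assms(1)] by (intro cut_cong) auto

lemma tau_word_words: "F \<in> words N \<Longrightarrow> tau_word F \<in> words N"
proof -
  have "prime_index (tau_prime P) = prime_index P" for P by (cases P) simp_all
  then show "F \<in> words N \<Longrightarrow> tau_word F \<in> words N" by (auto simp: words_def tau_word_def)
qed

lemma tau_word_is_TP: "P \<in> set (tau_word F) \<Longrightarrow> is_TP P"
proof -
  have "is_TP (tau_prime P)" for P by (cases P) simp_all
  then show "P \<in> set (tau_word F) \<Longrightarrow> is_TP P" by (auto simp: tau_word_def)
qed

text \<open>The permutation of any factorization dominates both the cut and \<open>|a - b|\<close>,
  hence it dominates \<open>q\<close>. A factorization as short as \<open>inv_count N q\<close> must
  have \<open>q\<close> itself as its permutation, which settles the one picked by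
  \<open>SOME\<close> in \<open>tau\<close>.\<close>

lemma length_characterization:
  assumes X: "X \<in> tangles N"
  obtains q where "q permutes {1..N}"
    "\<And>a b. a \<le> N \<Longrightarrow> b \<le> N \<Longrightarrow> csum q a b = mcut (mate X) a b"
    "tangle_length N X = inv_count N q"
    "tau N X = tangle_of N (perm_mate q)" "tau N X \<in> sym_tangles N"
proof -
  obtain F q where F: "F \<in> words N" "compose_word N F = X" and q: "q permutes {1..N}"
    and csum: "\<And>a b. a \<le> N \<Longrightarrow> b \<le> N \<Longrightarrow> csum q a b = mcut (mate X) a b"
    and len: "length F = inv_count N q"
    using factorization_attaining[OF matching_mate[OF X]] tangle_of_mate[OF X] by metis
  have lower: "inv_count N q \<le> length G \<and>
      (inv_count N q = length G \<longrightarrow> compose_word N (tau_word G) = tangle_of N (perm_mate q))"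
    if G: "factorization N X G" for G
  proof -
    obtain m p where m: "matching N m" "X = tangle_of N m" and p: "p permutes {1..N}"
      and le: "\<And>a b. a \<le> N \<Longrightarrow> b \<le> N \<Longrightarrow> cut m (region a b) \<le> csum p a b"
      and plen: "inv_count N p \<le> length G"
      and tau: "inv_count N p = length G \<Longrightarrow> compose_word N (tau_word G) = tangle_of N (perm_mate p)"
      using word_lower_bound[of G N] G unfolding factorization_def by metis
    have "csum q a b \<le> csum p a b" if "a \<le> N" "b \<le> N" for a b
      using csum[OF that] le[OF that] csum_ge_abs[OF p, of a b] cut_mate_tangle_of[OF m(1) that]
      by (simp add: mcut_def m(2))
    then have "inv_count N q \<le> inv_count N p" "inv_count N q = inv_count N p \<Longrightarrow> q = p"
      using inv_count_mono[OF p q] by auto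
    then show ?thesis using plen tau by auto
  qed
  have fact: "factorization N X F" using F by (simp add: factorization_def)
  have "tangle_length N X = inv_count N q"
    unfolding tangle_length_def using fact len lower by (intro Least_equality) auto
  moreover define G where "G = (SOME F. minimal_factorization N X F)"
  have "minimal_factorization N X F"
    using fact lower len by (simp add: minimal_factorization_def)
  then have G: "minimal_factorization N X G" unfolding G_def by (rule someI)
  then have GX: "factorization N X G" and "length G \<le> length F"
    using fact by (auto simp: minimal_factorization_def)
  then have tau: "compose_word N (tau_word G) = tangle_of N (perm_mate q)"
    using lower[OF GX] len by auto
  then have "tau N X = tangle_of N (perm_mate q)" by (simp add: tau_def G_def)
  moreover have "tau N X \<in> sym_tangles N"
    unfolding sym_tangles_def factorization_def tau_def G_def[symmetric]
    using GX tau_word_words[of G N] tau_word_is_TP[of _ G] by (auto simp: factorization_def)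
  ultimately show ?thesis using that q csum by blast
qed

text \<open>For a permutation \<open>mcut\<close> is \<open>csum\<close>, so the attained
  permutation and \<open>p\<close> dominate each other.\<close>

lemma tangle_length_perm:
  assumes p: "p permutes {1..N}"
  shows "tangle_length N (tangle_of N (perm_mate p)) = inv_count N p"
proof -
  note m = matching_perm_mate[OF p]
  obtain q where q: "q permutes {1..N}"
    and csum: "\<And>a b. a \<le> N \<Longrightarrow> b \<le> N \<Longrightarrow> csum q a b = mcut (mate (tangle_of N (perm_mate p))) a b"
    and len: "tangle_length N (tangle_of N (perm_mate p)) = inv_count N q"
    using length_characterization[OF tangle_of_in_tangles[OF m]] by metis
  have "csum q a b = csum p a b" if "a \<le> N" "b \<le> N" for a b
    using csum[OF that] cut_mate_tangle_of[OF m that] cut_perm_mate[OF p that] csum_ge_abs[OF p, of a b]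
    by (simp add: mcut_def)
  then have "inv_count N q = inv_count N p"
    using inv_count_mono[OF p q] inv_count_mono[OF q p] by (intro antisym) auto
  with len show ?thesis by simp
qed

lemma crosses_through:
  assumes "k \<in> {1..N}" "l \<in> {1..N}" "x \<in> {1..N}" "y \<in> {1..N}"
  shows "crosses N {Up k, Low x} {Up l, Low y} \<longleftrightarrow> k < l \<and> y < x \<or> l < k \<and> x < y"
proof
  assume "crosses N {Up k, Low x} {Up l, Low y}"
  then show "k < l \<and> y < x \<or> l < k \<and> x < y"
    using assms by (auto simp: crosses_def doubleton_eq_iff)
next
  assume "k < l \<and> y < x \<or> l < k \<and> x < y"
  then show "crosses N {Up k, Low x} {Up l, Low y}"
    unfolding crosses_def using assms
    by (intro exI[of _ "Up k"] exI[of _ "Low x"] exI[of _ "Up l"] exI[of _ "Low y"]) auto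
qed

text \<open>Ordering a crossing pair of edges by upper ends identifies it with an inversion.\<close>

lemma crossings_perm:
  assumes p: "p permutes {1..N}"
  shows "crossings N (tangle_of N (perm_mate p)) = inv_count N p"
proof -
  define e where "e k = {Up k, Low (p k)}" for k
  have e_inj: "e k = e l \<longleftrightarrow> k = l" for k l by (auto simp: e_def doubleton_eq_iff)
  have edges: "tangle_of N (perm_mate p) = e ` {1..N}"
  proof (intro equalityI subsetI)
    fix z assume "z \<in> tangle_of N (perm_mate p)"
    then obtain v where v: "v \<in> nodes N" "z = {v, perm_mate p v}" by (auto simp: tangle_of_def)
    show "z \<in> e ` {1..N}"
    proof (cases v)
      case (Up k)
      then show ?thesis using v by (auto simp: e_def)
    next
      case (Low k)
      then have "z = e (inv p k)" using v by (simp add: e_def insert_commute permutes_inverses[OF p])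
      moreover have "inv p k \<in> {1..N}"
        using v Low permutes_in_image[OF permutes_inv[OF p], of k] by simp
      ultimately show ?thesis by blast
    qed
  next
    fix z assume "z \<in> e ` {1..N}"
    then obtain k where "k \<in> {1..N}" "z = {Up k, perm_mate p (Up k)}" by (auto simp: e_def)
    then show "z \<in> tangle_of N (perm_mate p)" unfolding tangle_of_def by (intro image_eqI[of _ _ "Up k"]) auto
  qed
  have cross: "crosses N (e k) (e l) \<longleftrightarrow> k < l \<and> p l < p k \<or> l < k \<and> p k < p l"
    if "k \<in> {1..N}" "l \<in> {1..N}" for k l
    unfolding e_def using that permutes_in_image[OF p] by (intro crosses_through) blast+
  have "{{f, g} | f g. f \<in> tangle_of N (perm_mate p) \<and> g \<in> tangle_of N (perm_mate p) \<and> crosses N f g}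
      = (\<lambda>(k, l). {e k, e l}) ` inversions N p" (is "?L = ?h ` _")
  proof (intro equalityI subsetI)
    fix z assume "z \<in> ?L"
    then obtain k l where kl: "k \<in> {1..N}" "l \<in> {1..N}" "z = {e k, e l}" "crosses N (e k) (e l)"
      unfolding edges by blast
    then consider "(k, l) \<in> inversions N p" | "(l, k) \<in> inversions N p"
      using cross[OF kl(1,2)] by (auto simp: inversions_def)
    then show "z \<in> ?h ` inversions N p"
    proof cases
      case 1
      then show ?thesis using kl(3) by (intro image_eqI[of _ _ "(k, l)"]) auto
    next
      case 2
      then show ?thesis using kl(3) by (intro image_eqI[of _ _ "(l, k)"]) auto
    qed
  next
    fix z assume "z \<in> ?h ` inversions N p"
    then obtain k l where kl: "(k, l) \<in> inversions N p" "z = {e k, e l}" by auto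
    then have "k \<in> {1..N}" "l \<in> {1..N}" by (auto simp: inversions_def)
    moreover have "crosses N (e k) (e l)" using cross[OF calculation] kl(1) by (simp add: inversions_def)
    ultimately show "z \<in> ?L" unfolding edges using kl(2) by blast
  qed
  moreover have "inj_on ?h (inversions N p)"
    by (auto simp: inj_on_def inversions_def doubleton_eq_iff e_inj)
  ultimately show ?thesis by (simp add: crossings_def inv_count_def card_image)
qed

section \<open>Running time\<close>

definition triple :: "(state \<Rightarrow> bool) \<Rightarrow> prog \<Rightarrow> nat \<Rightarrow> (state \<Rightarrow> bool) \<Rightarrow> bool" where
  "triple P c T Q \<longleftrightarrow> (\<forall>s. P s \<longrightarrow> (\<exists>t s'. run c s t s' \<and> t \<le> T \<and> Q s'))"

lemma triple_conseq:
  "triple P c T Q \<Longrightarrow> (\<And>s. P' s \<Longrightarrow> P s) \<Longrightarrow> (\<And>s. Q s \<Longrightarrow> Q' s) \<Longrightarrow> T \<le> T' \<Longrightarrow> triple P' c T' Q'"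
  unfolding triple_def by (meson order_trans)

lemma triple_Seq:
  assumes "triple P c T R" "triple R d T' Q"
  shows "triple P (Seq c d) (T + T') Q"
  using assms unfolding triple_def by (metis add_mono run_Seq)

text \<open>The invariant is indexed by the number of completed iterations; each iteration pays 1
  for its test, and the last 1 is the failing test.\<close>

lemma triple_While:
  assumes body: "\<And>k. k < n \<Longrightarrow> triple (I k) c T (I (Suc k))"
    and test: "\<And>k s. k \<le> n \<Longrightarrow> I k s \<Longrightarrow> eval_test b s \<longleftrightarrow> k < n"
  shows "triple (I 0) (While b c) (n * (T + 1) + 1) (I n)"
proof -
  have "\<exists>t s'. run (While b c) s t s' \<and> t \<le> (n - k) * (T + 1) + 1 \<and> I n s'"
    if "k \<le> n" "I k s" for k s
    using that
  proof (induction k arbitrary: s rule: inc_induct)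
    case base
    then have "\<not> eval_test b s" using test[of n s] by simp
    from run_WhileFalse[OF this] base show ?case by (intro exI[of _ 1] exI[of _ s]) simp
  next
    case (step k)
    have "eval_test b s" using test[of k s] step by simp
    obtain t s' where c: "run c s t s'" "t \<le> T" "I (Suc k) s'"
      using body[of k] step unfolding triple_def by blast
    obtain t' s'' where w: "run (While b c) s' t' s''" "t' \<le> (n - Suc k) * (T + 1) + 1" "I n s''"
      using step.IH[OF c(3)] by blast
    have "run (While b c) s (t + t' + 1) s''"
      using \<open>eval_test b s\<close> c(1) w(1) by (rule run_WhileTrue)
    moreover have "n - k = Suc (n - Suc k)" using step by simp
    then have "t + t' + 1 \<le> (n - k) * (T + 1) + 1" using c(2) w(2) by simp
    ultimately show ?case using w(3) by blast
  qed
  from this[of 0] show ?thesis by (simp add: triple_def)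
qed

fun loop_free :: "prog \<Rightarrow> bool" where
  "loop_free (Seq c d) \<longleftrightarrow> loop_free c \<and> loop_free d"
| "loop_free (Cond b c d) \<longleftrightarrow> loop_free c \<and> loop_free d"
| "loop_free (While b c) \<longleftrightarrow> False"
| "loop_free _ \<longleftrightarrow> True"

fun exec :: "prog \<Rightarrow> state \<Rightarrow> state" where
  "exec Skip s = s"
| "exec (Assign x e) (r, m) = (r(x := eval_expr e (r, m)), m)"
| "exec (Write a x y) (r, m) = (r, m(a := (m a)(r x := r y)))"
| "exec (Seq c d) s = exec d (exec c s)"
| "exec (Cond b c d) s = (if eval_test b s then exec c s else exec d s)"
| "exec (While b c) s = s"

fun cost :: "prog \<Rightarrow> nat" where
  "cost (Seq c d) = cost c + cost d"
| "cost (Cond b c d) = max (cost c) (cost d) + 1"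
| "cost _ = 1"

text \<open>Loop bodies can thus be verified by symbolic evaluation of \<open>exec\<close>.\<close>

lemma run_exec: "loop_free c \<Longrightarrow> \<exists>t\<le>cost c. run c s t (exec c s)"
proof (induction c arbitrary: s)
  case Skip
  show ?case
    by (intro exI[of _ 1] conjI) (simp_all only: cost.simps exec.simps order_refl run_Skip)
next
  case (Assign x e)
  show ?case
    by (cases s, intro exI[of _ 1] conjI) (simp_all only: cost.simps exec.simps order_refl run_Assign)
next
  case (Write a x y)
  show ?case
    by (cases s, intro exI[of _ 1] conjI) (simp_all only: cost.simps exec.simps order_refl run_Write)
next
  case (Seq c d)
  then obtain t t' where "t \<le> cost c" "run c s t (exec c s)"
    "t' \<le> cost d" "run d (exec c s) t' (exec d (exec c s))"
    by (metis loop_free.simps(1))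
  then show ?case by (intro exI[of _ "t + t'"]) (auto intro: run_Seq)
next
  case (Cond b c d)
  show ?case
  proof (cases "eval_test b s")
    case True
    obtain t where t: "t \<le> cost c" "run c s t (exec c s)" using Cond.IH(1)[of s] Cond.prems by auto
    show ?thesis using run_CondTrue[OF True t(2), of d] True t(1) by (intro exI[of _ "t + 1"]) simp
  next
    case False
    obtain t where t: "t \<le> cost d" "run d s t (exec d s)" using Cond.IH(2)[of s] Cond.prems by auto
    show ?thesis using run_CondFalse[OF False t(2), of c] False t(1) by (intro exI[of _ "t + 1"]) simp
  qed
qed simp

lemma triple_exec:
  assumes "loop_free c" "\<And>r m. P (r, m) \<Longrightarrow> Q (exec c (r, m))"
  shows "triple P c (cost c) Q"
  using run_exec[OF assms(1)] assms(2) unfolding triple_def by fast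

text \<open>Registers: 0 holds \<open>N\<close>, 1 and 2 the current \<open>a\<close> and \<open>b\<close>, 3 holds \<open>N + 1\<close>, 4 the label bound for
  lower nodes of the region, 5 the label of a mate, 6 a cut value, 7 a distance \<open>\<bar>a - b\<bar>\<close>, 8 the value
  of the permutation at \<open>a\<close>, 9 the number of inversions,
  10 and 11 the index and entry for counting inversions. Array 1 holds the cuts of the regions
  \<open>(a, b)\<close> for the current \<open>a\<close>, array 2 the permutation, array 3 the distances.\<close>

definition init_body :: prog where
  "init_body =
    Seq (Assign 2 (Incr 2)) (Seq (Assign 4 (Incr 4)) (Seq (Assign 5 (Read 0 4))
    (Seq (Cond (Less 0 5) (Cond (Less 5 4) (Assign 6 (Decr 6)) (Assign 6 (Incr 6))) (Assign 6 (Incr 6)))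
    (Seq (Write 1 2 6) (Write 3 2 2)))))"

text \<open>The cut falls in this branch. The nested tests form the conjunction in the first part of
  \<open>less_perm_iff\<close>; \<open>outside_branch\<close> does the same for the disjunction in
  the second part.\<close>

definition inside_branch :: prog where
  "inside_branch =
    Seq (Cond (Less 2 1) (Cond (Less 7 6) Skip (Assign 8 (Incr 8))) Skip) (Assign 6 (Decr 6))"

definition outside_branch :: prog where
  "outside_branch =
    Seq (Cond (Less 2 1) (Assign 8 (Incr 8)) (Cond (Less 6 7) Skip (Assign 8 (Incr 8)))) (Assign 6 (Incr 6))"

definition row_body :: prog where
  "row_body =
    Seq (Assign 6 (Read 1 2)) (Seq (Assign 7 (Read 3 2))
    (Seq (Cond (Less 5 1) inside_branch
            (Cond (Less 0 5) (Cond (Less 5 4) inside_branch outside_branch) outside_branch))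
    (Seq (Cond (Less 2 1) (Assign 7 (Incr 7)) (Assign 7 (Decr 7)))
    (Seq (Write 1 2 6) (Seq (Write 3 2 7) (Seq (Assign 2 (Incr 2)) (Assign 4 (Incr 4))))))))"

definition inv_body :: prog where
  "inv_body =
    Seq (Assign 11 (Read 2 10)) (Seq (Cond (Less 8 11) (Assign 9 (Incr 9)) Skip) (Assign 10 (Incr 10)))"

definition row_start :: prog where
  "row_start =
    Seq (Assign 1 (Incr 1)) (Seq (Assign 5 (Read 0 1))
    (Seq (Assign 2 (Const 0)) (Seq (Assign 4 (Reg 3)) (Assign 8 (Const 0)))))"

definition row_end :: prog where
  "row_end = Seq (Write 2 1 8) (Assign 10 (Const 0))"

definition outer_body :: prog where
  "outer_body = Seq row_start (Seq (While (Less 2 3) row_body) (Seq row_end (While (Less 10 1) inv_body)))"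

definition length_prog :: prog where
  "length_prog =
    Seq (Assign 4 (Reg 0)) (Seq (While (Less 2 0) init_body)
    (Seq (Assign 3 (Incr 0)) (Seq (While (Less 1 0) outer_body) (Assign 0 (Reg 9)))))"

text \<open>Labels list the upper nodes before the lower ones, so membership in a region is a test
  for two label intervals and takes constant time.\<close>

lemma label_less_iff:
  assumes "v \<in> nodes N" "v \<noteq> Up a" "1 \<le> a" "a \<le> N" "b \<le> N"
  shows "v \<in> region (a - 1) b \<longleftrightarrow> label N v < a \<or> N < label N v \<and> label N v < N + 1 + b"
  using assms by (cases v) auto

locale length_computation =
  fixes N :: nat and X :: tangle and q :: "nat \<Rightarrow> nat"
  assumes X: "X \<in> tangles N" and q: "q permutes {1..N}"
    and csum_eq: "a \<le> N \<Longrightarrow> b \<le> N \<Longrightarrow> csum q a b = mcut (mate X) a b"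
begin

definition cutn :: "nat \<Rightarrow> nat \<Rightarrow> nat" where
  "cutn a b = nat (cut (mate X) (region a b))"

lemma int_cutn: "int (cutn a b) = cut (mate X) (region a b)"
  by (simp add: cutn_def cut_nonneg)

text \<open>The machine cannot subtract two registers, so distances are kept in an array and updated
  by 1 like the cuts.\<close>

definition dist :: "nat \<Rightarrow> nat \<Rightarrow> nat" where
  "dist a b = nat \<bar>int a - int b\<bar>"

definition input :: "nat \<Rightarrow> nat" where
  "input = snd (input_state N X) 0"

lemma matching: "matching N (mate X)"
  by (rule matching_mate[OF X])

lemma input_Up: "1 \<le> a \<Longrightarrow> a \<le> N \<Longrightarrow> input a = label N (mate X (Up a))"
  by (simp add: input_def input_state_def node_at_def)

lemma input_Low: "1 \<le> b \<Longrightarrow> b \<le> N \<Longrightarrow> input (N + b) = label N (mate X (Low b))"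
  by (simp add: input_def input_state_def node_at_def)

lemma cutn_Suc:
  assumes "Suc a \<le> N" "b \<le> N"
  shows "mate X (Up (Suc a)) \<in> region a b \<Longrightarrow> cutn a b = Suc (cutn (Suc a) b)"
    "mate X (Up (Suc a)) \<notin> region a b \<Longrightarrow> cutn (Suc a) b = Suc (cutn a b)"
  using cut_Suc_Up[OF matching assms] int_cutn[of a b] int_cutn[of "Suc a" b] by simp_all

text \<open>\<open>b < q (Suc a)\<close> says that \<open>csum\<close>, the maximum of distance and
  cut, rises by 1 from row \<open>a\<close> to the next; otherwise it falls by 1. The distance rises
  iff \<open>b < Suc a\<close>, and the cut moves according to the mate.\<close>

lemma less_perm_iff:
  assumes ab: "Suc a \<le> N" "b \<le> N"
  shows "mate X (Up (Suc a)) \<in> region a b \<Longrightarrow> b < q (Suc a) \<longleftrightarrow> b < Suc a \<and> cutn a b \<le> dist a b"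
    "mate X (Up (Suc a)) \<notin> region a b \<Longrightarrow> b < q (Suc a) \<longleftrightarrow> b < Suc a \<or> dist a b \<le> cutn a b"
proof -
  have "max \<bar>int (Suc a) - int b\<bar> (int (cutn (Suc a) b)) =
      max \<bar>int a - int b\<bar> (int (cutn a b)) + (if q (Suc a) \<le> b then -1 else 1)"
    using csum_eq[of "Suc a" b] csum_eq[of a b] ab csum_Suc[of q a b] by (simp add: mcut_def int_cutn)
  moreover have "int (dist a b) = \<bar>int a - int b\<bar>" by (simp add: dist_def)
  ultimately show "mate X (Up (Suc a)) \<in> region a b \<Longrightarrow> b < q (Suc a) \<longleftrightarrow> b < Suc a \<and> cutn a b \<le> dist a b"
    "mate X (Up (Suc a)) \<notin> region a b \<Longrightarrow> b < q (Suc a) \<longleftrightarrow> b < Suc a \<or> dist a b \<le> cutn a b"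
    using cutn_Suc[OF ab] by (auto simp: max_def abs_if split: if_splits)
qed

lemma dist_Suc:
  "b < Suc a \<Longrightarrow> dist (Suc a) b = Suc (dist a b)" "\<not> b < Suc a \<Longrightarrow> dist (Suc a) b = dist a b - 1"
  by (auto simp: dist_def)

text \<open>Entry 0 of arrays 1 and 3 and all of array 2 start with the correct value 0. In row 0
  the distance to \<open>b\<close> is \<open>b\<close> itself.\<close>

definition init_inv :: "nat \<Rightarrow> state \<Rightarrow> bool" where
  "init_inv b = (\<lambda>(r, m). r 0 = N \<and> r 1 = 0 \<and> r 2 = b \<and> r 4 = N + b \<and> r 6 = cutn 0 b \<and> r 9 = 0 \<and>
    m 0 = input \<and> (\<forall>i\<le>b. m 1 i = cutn 0 i \<and> m 3 i = i) \<and> (\<forall>i. m 2 i = 0))"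

definition outer_inv :: "nat \<Rightarrow> state \<Rightarrow> bool" where
  "outer_inv a = (\<lambda>(r, m). r 0 = N \<and> r 1 = a \<and> r 3 = N + 1 \<and> r 9 = inv_count a q \<and>
    m 0 = input \<and> (\<forall>i\<le>N. m 1 i = cutn a i \<and> m 3 i = dist a i) \<and>
    (\<forall>i. m 2 i = (if 1 \<le> i \<and> i \<le> a then q i else 0)))"

text \<open>Arrays 1 and 3 are overwritten in place: entries below \<open>b\<close> belong to the
  next row. Register 8 counts the columns seen so far that lie below \<open>q (Suc a)\<close>,
  starting with column 0.\<close>

definition row_inv :: "nat \<Rightarrow> nat \<Rightarrow> state \<Rightarrow> bool" where
  "row_inv a b = (\<lambda>(r, m). r 0 = N \<and> r 1 = Suc a \<and> r 2 = b \<and> r 3 = N + 1 \<and> r 4 = N + 1 + b \<and>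
    r 5 = label N (mate X (Up (Suc a))) \<and> r 8 = min b (q (Suc a)) \<and> r 9 = inv_count a q \<and>
    m 0 = input \<and> (\<forall>i\<le>N. m 1 i = cutn (if i < b then Suc a else a) i \<and>
      m 3 i = dist (if i < b then Suc a else a) i) \<and>
    (\<forall>i. m 2 i = (if 1 \<le> i \<and> i \<le> a then q i else 0)))"

definition inv_inv :: "nat \<Rightarrow> nat \<Rightarrow> state \<Rightarrow> bool" where
  "inv_inv a y = (\<lambda>(r, m). r 0 = N \<and> r 1 = Suc a \<and> r 3 = N + 1 \<and> r 8 = q (Suc a) \<and> r 10 = y \<and>
    r 9 = inv_count a q + card {x. 1 \<le> x \<and> x < y \<and> q (Suc a) < q x} \<and>
    m 0 = input \<and> (\<forall>i\<le>N. m 1 i = cutn (Suc a) i \<and> m 3 i = dist (Suc a) i) \<and>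
    (\<forall>i. m 2 i = (if 1 \<le> i \<and> i \<le> Suc a then q i else 0)))"

lemma init_step:
  assumes b: "b < N"
  shows "triple (init_inv b) init_body (cost init_body) (init_inv (Suc b))"
proof (rule triple_exec)
  show "loop_free init_body" by (simp add: init_body_def)
  fix r m assume inv: "init_inv b (r, m)"
  let ?v = "mate X (Low (Suc b))"
  have v: "?v \<in> nodes N" "?v \<noteq> Low (Suc b)" using matchingD[OF matching, of "Low (Suc b)"] b by auto
  have lab: "?v \<in> region 0 b \<longleftrightarrow> N < label N ?v \<and> label N ?v < Suc (N + b)"
    using v b by (cases ?v) auto
  have inp: "input (Suc (N + b)) = label N ?v" using input_Low[of "Suc b"] b by simp
  have "cut (mate X) (region 0 (Suc b)) =
      cut (mate X) (region 0 b) + (if ?v \<in> region 0 b then -1 else 1)"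
    using cut_Suc_Low[OF matching] b by simp
  then have cut: "cutn 0 (Suc b) = (if ?v \<in> region 0 b then cutn 0 b - 1 else Suc (cutn 0 b))"
    using int_cutn[of 0 b] int_cutn[of 0 "Suc b"] by (simp split: if_splits)
  show "init_inv (Suc b) (exec init_body (r, m))"
    using inv by (auto simp: init_inv_def init_body_def inp lab cut le_Suc_eq)
qed

lemma row_step:
  assumes a: "Suc a \<le> N" and b: "b < Suc N"
  shows "triple (row_inv a b) row_body (cost row_body) (row_inv a (Suc b))"
proof (rule triple_exec)
  show "loop_free row_body" by (simp add: row_body_def inside_branch_def outside_branch_def)
  fix r m assume inv: "row_inv a b (r, m)"
  let ?v = "mate X (Up (Suc a))"
  have bN: "b \<le> N" using b by simp
  have v: "?v \<in> nodes N" "?v \<noteq> Up (Suc a)" using matchingD[OF matching, of "Up (Suc a)"] a by auto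
  have lab: "?v \<in> region a b \<longleftrightarrow>
      label N ?v < Suc a \<or> N < label N ?v \<and> label N ?v < N + 1 + b"
    using label_less_iff[OF v _ a bN] by simp
  have min: "min (Suc b) (q (Suc a)) = (if b < q (Suc a) then Suc (min b (q (Suc a))) else min b (q (Suc a)))"
    by auto
  obtain r1 where r1: "exec (Seq (Assign 6 (Read 1 2)) (Assign 7 (Read 3 2))) (r, m) = (r1, m)"
    and r1_vals: "r1 = r(6 := cutn a b, 7 := dist a b)"
    using inv bN by (simp add: row_inv_def)
  define c where "c = Cond (Less 5 1) inside_branch
    (Cond (Less 0 5) (Cond (Less 5 4) inside_branch outside_branch) outside_branch)"
  have c: "exec c (r1, m) = (r1(6 := cutn (Suc a) b, 8 := min (Suc b) (q (Suc a))), m)"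
  proof (cases "?v \<in> region a b")
    case True
    have "exec c (r1, m) = exec inside_branch (r1, m)"
      using True lab inv by (auto simp: c_def r1_vals row_inv_def)
    also have "\<dots> = (r1(6 := cutn (Suc a) b, 8 := min (Suc b) (q (Suc a))), m)"
      using inv less_perm_iff(1)[OF a bN True] cutn_Suc(1)[OF a bN True] unfolding min
      by (auto simp: inside_branch_def r1_vals row_inv_def fun_eq_iff)
    finally show ?thesis .
  next
    case False
    have "exec c (r1, m) = exec outside_branch (r1, m)"
      using False lab inv by (auto simp: c_def r1_vals row_inv_def)
    also have "\<dots> = (r1(6 := cutn (Suc a) b, 8 := min (Suc b) (q (Suc a))), m)"
      using inv less_perm_iff(2)[OF a bN False] cutn_Suc(2)[OF a bN False] unfolding min
      by (auto simp: outside_branch_def r1_vals row_inv_def fun_eq_iff)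
    finally show ?thesis .
  qed
  have "exec row_body (r, m) =
      exec (Seq (Cond (Less 2 1) (Assign 7 (Incr 7)) (Assign 7 (Decr 7)))
        (Seq (Write 1 2 6) (Seq (Write 3 2 7) (Seq (Assign 2 (Incr 2)) (Assign 4 (Incr 4))))))
        (exec c (r1, m))"
    using r1 by (simp add: row_body_def c_def)
  then show "row_inv a (Suc b) (exec row_body (r, m))"
    unfolding c using inv bN dist_Suc[of b a]
    by (auto simp: row_inv_def r1_vals less_Suc_eq)
qed

text \<open>The scan includes index 0, where array 2 holds 0; this exceeds no value of
  \<open>q\<close> and is not counted.\<close>

lemma inv_step:
  assumes a: "Suc a \<le> N" and y: "y < Suc a"
  shows "triple (inv_inv a y) inv_body (cost inv_body) (inv_inv a (Suc y))"
proof (rule triple_exec)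
  show "loop_free inv_body" by (simp add: inv_body_def)
  fix r m assume inv: "inv_inv a y (r, m)"
  have "{x. 1 \<le> x \<and> x < Suc y \<and> q (Suc a) < q x} =
      (if 1 \<le> y \<and> q (Suc a) < q y then insert y {x. 1 \<le> x \<and> x < y \<and> q (Suc a) < q x}
       else {x. 1 \<le> x \<and> x < y \<and> q (Suc a) < q x})"
    by (auto simp: less_Suc_eq)
  then have card: "card {x. 1 \<le> x \<and> x < Suc y \<and> q (Suc a) < q x} =
      (if 1 \<le> y \<and> q (Suc a) < q y then Suc (card {x. 1 \<le> x \<and> x < y \<and> q (Suc a) < q x})
       else card {x. 1 \<le> x \<and> x < y \<and> q (Suc a) < q x})"
    by simp
  show "inv_inv a (Suc y) (exec inv_body (r, m))"
    using inv y unfolding inv_inv_def by (simp add: inv_body_def card del: One_nat_def)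
qed

lemma inv_count_Suc:
  "inv_count (Suc a) q = inv_count a q + card {x. 1 \<le> x \<and> x < Suc a \<and> q (Suc a) < q x}"
proof -
  let ?S = "{x. 1 \<le> x \<and> x < Suc a \<and> q (Suc a) < q x}"
  have "inversions (Suc a) q = inversions a q \<union> (\<lambda>x. (x, Suc a)) ` ?S"
    by (auto simp: inversions_def le_Suc_eq)
  moreover have "inversions a q \<inter> (\<lambda>x. (x, Suc a)) ` ?S = {}" by (auto simp: inversions_def)
  moreover have "finite ?S" by (rule finite_subset[of _ "{..a}"]) auto
  ultimately show ?thesis
    by (simp add: inv_count_def card_Un_disjoint finite_inversions card_image inj_on_def)
qed

lemma inv_count_0: "inv_count 0 p = 0"
proof -
  have "inversions 0 p = {}" by (auto simp: inversions_def)
  then show ?thesis by (simp add: inv_count_def)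
qed

definition outer_cost :: nat where
  "outer_cost = cost row_start + (((N + 1) * (cost row_body + 1) + 1) +
    (cost row_end + (N * (cost inv_body + 1) + 1)))"

lemma outer_step:
  assumes a: "a < N"
  shows "triple (outer_inv a) outer_body outer_cost (outer_inv (Suc a))"
  unfolding outer_body_def outer_cost_def
proof (intro triple_Seq)
  show "triple (outer_inv a) row_start (cost row_start) (row_inv a 0)"
  proof (rule triple_exec)
    show "loop_free row_start" by (simp add: row_start_def)
    fix r m assume "outer_inv a (r, m)"
    then show "row_inv a 0 (exec row_start (r, m))"
      using a input_Up[of "Suc a"] by (simp add: outer_inv_def row_inv_def row_start_def)
  qed
  \<comment> \<open>Columns run from 0 to \<open>N\<close>, hence \<open>N + 1\<close>
    iterations.\<close>
  show "triple (row_inv a 0) (While (Less 2 3) row_body) ((N + 1) * (cost row_body + 1) + 1) (row_inv a (N + 1))"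
    using a by (intro triple_While row_step) (auto simp: row_inv_def)
  show "triple (row_inv a (N + 1)) row_end (cost row_end) (inv_inv a 0)"
  proof (rule triple_exec)
    show "loop_free row_end" by (simp add: row_end_def)
    fix r m assume "row_inv a (N + 1) (r, m)"
    moreover have "q (Suc a) \<le> N" using permutes_in_image[OF q, of "Suc a"] a by simp
    ultimately show "inv_inv a 0 (exec row_end (r, m))"
      by (auto simp: row_inv_def inv_inv_def row_end_def)
  qed
  have "triple (inv_inv a 0) (While (Less 10 1) inv_body) (Suc a * (cost inv_body + 1) + 1) (inv_inv a (Suc a))"
    using a by (intro triple_While inv_step) (auto simp: inv_inv_def)
  then show "triple (inv_inv a 0) (While (Less 10 1) inv_body) (N * (cost inv_body + 1) + 1) (outer_inv (Suc a))"
  proof (rule triple_conseq)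
    show "Suc a * (cost inv_body + 1) + 1 \<le> N * (cost inv_body + 1) + 1"
      using a by (intro add_right_mono mult_right_mono) auto
  qed (auto simp: inv_inv_def outer_inv_def inv_count_Suc)
qed

definition total_cost :: nat where
  "total_cost = 1 + ((N * (cost init_body + 1) + 1) + (1 + ((N * (outer_cost + 1) + 1) + 1)))"

lemma length_prog_correct:
  "triple (\<lambda>s. s = input_state N X) length_prog total_cost (\<lambda>s. fst s 0 = inv_count N q)"
  unfolding length_prog_def total_cost_def
proof (intro triple_Seq)
  have exec1: "triple P (Assign x e) 1 Q" if "\<And>r m. P (r, m) \<Longrightarrow> Q (r(x := eval_expr e (r, m)), m)" for P x e Q
    using triple_exec[of "Assign x e" P Q] that by simp
  show "triple (\<lambda>s. s = input_state N X) (Assign 4 (Reg 0)) 1 (init_inv 0)"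
    by (rule exec1) (auto simp: init_inv_def input_def input_state_def cutn_def)
  show "triple (init_inv 0) (While (Less 2 0) init_body) (N * (cost init_body + 1) + 1) (init_inv N)"
    by (intro triple_While init_step) (auto simp: init_inv_def)
  show "triple (init_inv N) (Assign 3 (Incr 0)) 1 (outer_inv 0)"
    by (rule exec1) (auto simp: init_inv_def outer_inv_def dist_def inv_count_0)
  show "triple (outer_inv 0) (While (Less 1 0) outer_body) (N * (outer_cost + 1) + 1) (outer_inv N)"
    by (intro triple_While outer_step) (auto simp: outer_inv_def)
  show "triple (outer_inv N) (Assign 0 (Reg 9)) 1 (\<lambda>s. fst s 0 = inv_count N q)"
    by (rule exec1) (auto simp: outer_inv_def)
qed

text \<open>Each 10 generously rounds up the overhead of tests and assignments.\<close>

lemma total_cost_le: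
  "total_cost \<le> 10 + N * (cost init_body + cost row_start + cost row_body + cost row_end + 10)
    + N * N * (cost row_body + cost inv_body + 10)"
  by (simp add: total_cost_def outer_cost_def algebra_simps)

end

section \<open>The quadratic bound and the theorem\<close>

lemma tau_length_computable: "computable_in_time_O tau_length (\<lambda>N. real N ^ 2)"
proof -
  define A where "A = cost init_body + cost row_start + cost row_body + cost row_end + 10"
  define B where "B = cost row_body + cost inv_body + 10"
  define f where "f N = 10 + N * A + N * N * B" for N
  have "(\<lambda>N. real (f N)) \<in> O(\<lambda>N. real N ^ 2)"
  proof (rule bigoI)
    have "f N \<le> (10 + A + B) * N ^ 2" if "1 \<le> N" for N
    proof -
      have "1 \<le> N * N" "N \<le> N * N" using that by simp_all
      then have "f N \<le> 10 * (N * N) + N * N * A + N * N * B"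
        unfolding f_def by (intro add_mono mult_le_mono1) simp_all
      also have "\<dots> = (10 + A + B) * N ^ 2" by (simp add: power2_eq_square algebra_simps)
      finally show ?thesis .
    qed
    then have "real (f N) \<le> real ((10 + A + B) * N ^ 2)" if "1 \<le> N" for N
      unfolding of_nat_le_iff using that by blast
    then have "norm (real (f N)) \<le> real (10 + A + B) * norm (real N ^ 2)" if "1 \<le> N" for N
      using that by simp
    then show "\<forall>\<^sub>F N in at_top. norm (real (f N)) \<le> real (10 + A + B) * norm (real N ^ 2)"
      using eventually_ge_at_top[of "1::nat"] by (rule eventually_mono[rotated])
  qed
  moreover have "\<exists>t s. run length_prog (input_state N X) t s \<and> t \<le> f N \<and> fst s 0 = tau_length N X"
    if X: "X \<in> tangles N" for N X
  proof -
    obtain q where q: "q permutes {1..N}"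
      and csum: "\<And>a b. a \<le> N \<Longrightarrow> b \<le> N \<Longrightarrow> csum q a b = mcut (mate X) a b"
      and tau: "tau N X = tangle_of N (perm_mate q)"
      using length_characterization[OF X] by metis
    \<comment> \<open>\<open>q\<close> only specifies the output; the program recovers it from the
      labels of the mates.\<close>
    interpret length_computation N X q using X q csum by unfold_locales
    have "tau_length N X = inv_count N q" by (simp add: tau_length_def tau tangle_length_perm[OF q])
    moreover have "total_cost \<le> f N" using total_cost_le by (simp add: f_def A_def B_def)
    ultimately show ?thesis using length_prog_correct unfolding triple_def by (metis order_trans)
  qed
  ultimately show ?thesis unfolding computable_in_time_O_def by blast
qed

theorem mainTheorem3:
  assumes "assumption1" and "assumption2"
  shows "(\<forall>N. \<forall>X\<in>tangles N.
            tangle_length N X = tau_length N X \<and>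
            tau N X \<in> sym_tangles N \<and>
            tau_length N X = crossings N (tau N X)) \<and>
         computable_in_time_O tau_length (\<lambda>N. real N ^ 2)"
proof (intro conjI allI ballI)
  fix N X assume X: "X \<in> tangles N"
  obtain q where q: "q permutes {1..N}" and len: "tangle_length N X = inv_count N q"
    and tau: "tau N X = tangle_of N (perm_mate q)" "tau N X \<in> sym_tangles N"
    using length_characterization[OF X] by metis
  have "tau_length N X = inv_count N q"
    by (simp add: tau_length_def tau(1) tangle_length_perm[OF q])
  then show "tangle_length N X = tau_length N X" "tau N X \<in> sym_tangles N"
    "tau_length N X = crossings N (tau N X)"
    using len tau crossings_perm[OF q] by simp_all
qed (rule tau_length_computable)

end
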